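(* Let $p \geq 5$ be a prime and let $n$ be a non-negative integer with $n \leq p^4-1$ and $n$ not divisible by $p$. Suppose that the monomial $f = x^n$ is $3$-PN over $\mathbb{F}_{p^4}$. Then $n = 4$.
   Context: $\mathbb{F}_q$ denotes the finite field with $q$ elements. For a polynomial $f \in \mathbb{F}_q[x]$ and $a_1,\dots,a_k \in \mathbb{F}_q$, the $k$-th finite difference of $f$ in directions $(a_1,\dots,a_k)$ is defined recursively by $\nabla_{a}^1 f = f(x+a)-f(x)$ and $\nabla_{a_1,\dots,a_k}^k f = g(x+a_k)-g(x)$, where $g(x) = \nabla_{a_1,\dots,a_{k-1}}^{k-1} f$. The polynomial $f$ is called $k$-PN over $\mathbb{F}_q$ if, for every choice of $(a_1,\dots,a_k)$ with all $a_i \in \mathbb{F}_q$ and $a_i \neq 0$, the function $\mathbb{F}_q \to \mathbb{F}_q$ associated to $\nabla_{a_1,\dots,a_k}^k f$ is a bijection. *)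

theory Defs
  imports "HOL-Computational_Algebra.Computational_Algebra" "HOL-Library.Cardinality"
begin

(* Directions are given by a function a, of which only the values a 1, ..., a k are used. *)
primrec finite_difference :: "nat \<Rightarrow> (nat \<Rightarrow> 'a::comm_ring_1) \<Rightarrow> 'a poly \<Rightarrow> 'a poly" where
  "finite_difference 0 a f = f"
| "finite_difference (Suc k) a f =
     (let g = finite_difference k a f in pcompose g [:a (Suc k), 1:] - g)"

definition k_PN :: "nat \<Rightarrow> 'a::{field,finite} poly \<Rightarrow> bool" where
  "k_PN k f \<longleftrightarrow>
     (\<forall>a. (\<forall>i\<in>{1..k}. a i \<noteq> 0) \<longrightarrow> bij (poly (finite_difference k a f)))"

end

theory Submission
  imports Defs
begin

text \<open>
  By Hermite's criterion, a permutation \<open>g\<close> of a finite field of order \<open>q\<close> has vanishing power sums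
  \<open>\<Sum>x. g x ^ m\<close> for \<open>0 < m < q - 1\<close>. This is applied to third differences of \<open>x ^ n\<close> on a
  chain of subfields and on lines over them.

  Over the prime field a planar function \<open>\<phi>\<close> satisfies \<open>\<Sum>x. (u * x + \<phi> x) ^ m = 0\<close> for
  \<open>2 * m < p - 1\<close>. Taking for \<open>\<phi>\<close> a second difference of \<open>x ^ n\<close> and looking at the
  coefficients in \<open>u\<close> shows \<open>n \<equiv> 4\<close> modulo \<open>p - 1\<close>.

  For \<open>Q = p\<close> and then \<open>Q = p\<^sup>2\<close> write \<open>x ^ n = x ^ A * (x ^ Q) ^ B\<close> on the field of order
  \<open>Q\<^sup>2\<close>; what is known about \<open>n\<close> modulo \<open>Q - 1\<close> leaves few values of \<open>A + B\<close> and of the digit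
  sums. If \<open>A + B = 4\<close> with \<open>A, B > 0\<close>, explicit directions give two equal values of a third
  difference. If \<open>A + B = Q + 3\<close> and no digit is small, the correlation of \<open>x ^ n\<close> with its
  \<open>Q\<close>-th power is a nonzero multiple of the fourth power of the norm, which contradicts Hermite's
  criterion with exponent \<open>1 + Q\<close>. The remaining case, digit sums \<open>n0 + n2 = 3\<close> and
  \<open>n1 + n3 = p\<close>, is excluded by the criterion with exponent \<open>1 + p\<close> on the line
  \<open>z ^ p\<^sup>2 = - z\<close>, after extracting a single coefficient.
\<close>

section \<open>Power sums over roots of unity\<close>

lemma of_nat_CARD_eq_0: "of_nat CARD('a::{field,finite}) = (0::'a)"
proof -
  have "(\<Sum>x\<in>UNIV. x) = (\<Sum>x\<in>UNIV. x + (1::'a))"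
    by (rule sum.reindex_bij_witness[of _ "\<lambda>x. x + 1" "\<lambda>x. x - 1"]) auto
  then show ?thesis by (simp add: sum.distrib)
qed

lemma power_CARD_minus_1:
  fixes x :: "'a::{field,finite}"
  assumes "x \<noteq> 0"
  shows "x ^ (CARD('a) - 1) = 1"
proof -
  have "(\<Prod>y\<in>UNIV - {0}. y) = (\<Prod>y\<in>UNIV - {0}. x * y)"
    by (rule prod.reindex_bij_witness[of _ "\<lambda>y. x * y" "\<lambda>y. y / x"]) (use assms in auto)
  then have "(\<Prod>y\<in>UNIV - {0}. y) * 1 = (\<Prod>y\<in>UNIV - {0}. y) * x ^ card (UNIV - {0::'a})"
    by (simp add: prod.distrib mult.commute)
  moreover have "(\<Prod>y\<in>UNIV - {0::'a}. y) \<noteq> 0" by simp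
  ultimately show ?thesis by (simp add: card_Diff_singleton)
qed

lemma card_roots_of_unity_le:
  assumes "d > 0"
  shows "card {x::'a::{field,finite}. x ^ d = 1} \<le> d"
proof -
  let ?f = "monom 1 d - 1 :: 'a poly"
  have "coeff ?f d = 1" using assms by (simp add: coeff_1)
  then have "?f \<noteq> 0" by (metis coeff_0 zero_neq_one)
  moreover have "degree ?f \<le> d" by (intro degree_diff_le) (auto simp: degree_monom_le)
  moreover have "{x. poly ?f x = 0} = {x. x ^ d = 1}" by (simp add: poly_monom)
  ultimately show ?thesis using card_poly_roots_bound[of ?f] by simp
qed

text \<open>With \<open>e\<close> the cofactor of d, x ^ (d * e) - 1 splits as (x ^ d - 1) times a
  polynomial of degree at most d * (e - 1). Every nonzero element is a root of the product, so at
  least d of them are roots of the first factor.\<close>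

lemma card_roots_of_unity:
  assumes "d dvd CARD('a::{field,finite}) - 1"
  shows "card {x::'a. x ^ d = 1} = d"
proof -
  have "card {0, 1::'a} \<le> CARD('a)" by (rule card_mono) auto
  then have C: "CARD('a) \<ge> 2" by simp
  obtain e where e: "CARD('a) - 1 = d * e" using assms by auto
  with C have de: "d > 0" "e > 0" by (auto intro!: Nat.gr0I)
  let ?g = "\<Sum>i<e. monom 1 (d * i) :: 'a poly"
  have "poly ?g 0 = (\<Sum>i<e. if i = 0 then 1 else 0)"
    using de by (auto simp: poly_sum poly_monom power_0_left intro!: sum.cong)
  then have "?g \<noteq> 0" using de by auto
  moreover have "degree ?g \<le> d * (e - 1)"
  proof (rule degree_sum_le)
    fix i assume "i \<in> {..<e}"
    then have "d * i \<le> d * (e - 1)" by (intro mult_left_mono) auto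
    then show "degree (monom (1::'a) (d * i)) \<le> d * (e - 1)"
      using degree_monom_le le_trans by blast
  qed simp
  ultimately have g: "card {x. poly ?g x = 0} \<le> d * (e - 1)"
    using card_poly_roots_bound[of ?g] by simp
  have "x ^ d = 1 \<or> poly ?g x = 0" if "x \<noteq> 0" for x :: 'a
  proof -
    have "(x ^ d) ^ e - 1 = (x ^ d - 1) * (\<Sum>i<e. (x ^ d) ^ i)"
      by (rule power_diff_1_eq)
    moreover have "(x ^ d) ^ e = 1"
      using power_CARD_minus_1[OF that] e by (simp add: power_mult)
    moreover have "poly ?g x = (\<Sum>i<e. (x ^ d) ^ i)"
      by (simp add: poly_sum poly_monom power_mult)
    ultimately show ?thesis by auto
  qed
  then have "UNIV - {0} \<subseteq> {x::'a. x ^ d = 1} \<union> {x. poly ?g x = 0}" by auto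
  then have "card (UNIV - {0::'a}) \<le> card ({x::'a. x ^ d = 1} \<union> {x. poly ?g x = 0})"
    by (intro card_mono) auto
  also have "\<dots> \<le> card {x::'a. x ^ d = 1} + d * (e - 1)"
    by (rule order_trans[OF card_Un_le]) (use g in simp)
  finally have "d * e \<le> card {x::'a. x ^ d = 1} + d * (e - 1)"
    using e by (simp add: card_Diff_singleton)
  then have "d \<le> card {x::'a. x ^ d = 1}"
    using de by (cases e) (auto simp: algebra_simps)
  with card_roots_of_unity_le[OF \<open>d > 0\<close>, where ?'a = 'a] show ?thesis by simp
qed

lemma card_power_eq:
  fixes x0 :: "'a::{field,finite}"
  assumes "d dvd CARD('a) - 1" "x0 \<noteq> 0" "x0 ^ d = c"
  shows "card {x. x ^ d = c} = d"
proof -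
  have "bij_betw (\<lambda>x. x0 * x) {x. x ^ d = 1} {x. x ^ d = c}"
    by (rule bij_betw_byWitness[where f' = "\<lambda>x. x / x0"])
      (use assms in \<open>auto simp: power_mult_distrib power_divide\<close>)
  then show ?thesis using bij_betw_same_card card_roots_of_unity[OF assms(1)] by fastforce
qed

text \<open>Multiplication by a d-th root of unity \<open>y\<close> with y ^ k distinct from 1
  permutes the summation set and scales the sum by y ^ k. Such a \<open>y\<close> exists because x ^
  (k mod d) = 1 has fewer than d solutions.\<close>

lemma sum_power_of_roots:
  fixes c :: "'a::{field,finite}"
  assumes d: "d dvd CARD('a) - 1" and k: "\<not> d dvd k"
  shows "(\<Sum>x | x ^ d = c. x ^ k) = 0"
proof -
  have "d > 0"
  proof (rule ccontr)
    assume "\<not> d > 0"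
    with d have "CARD('a) \<le> 1" by simp
    moreover have "card {0, 1::'a} \<le> CARD('a)" by (rule card_mono) auto
    ultimately show False by simp
  qed
  with k have r: "0 < k mod d" "k mod d < d" by (auto simp: mod_greater_zero_iff_not_dvd)
  have "\<not> {x::'a. x ^ d = 1} \<subseteq> {x. x ^ (k mod d) = 1}"
  proof
    assume "{x::'a. x ^ d = 1} \<subseteq> {x. x ^ (k mod d) = 1}"
    then have "card {x::'a. x ^ d = 1} \<le> card {x::'a. x ^ (k mod d) = 1}"
      by (intro card_mono) auto
    also have "\<dots> \<le> k mod d" using r by (intro card_roots_of_unity_le) auto
    finally show False using card_roots_of_unity[OF d] r by simp
  qed
  then obtain y :: 'a where y: "y ^ d = 1" "y ^ (k mod d) \<noteq> 1" by auto
  have "y ^ k = y ^ (d * (k div d) + k mod d)" by simp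
  also have "\<dots> = y ^ (k mod d)" unfolding power_add power_mult y by simp
  finally have yk: "y ^ k \<noteq> 1" using y by simp
  have "y \<noteq> 0" using y \<open>d > 0\<close> by (auto simp: power_0_left)
  have "(\<Sum>x | x ^ d = c. x ^ k) = (\<Sum>x | x ^ d = c. (y * x) ^ k)"
    by (rule sum.reindex_bij_witness[of _ "\<lambda>x. y * x" "\<lambda>x. x / y"])
      (use y \<open>y \<noteq> 0\<close> in \<open>auto simp: power_mult_distrib power_divide\<close>)
  also have "\<dots> = y ^ k * (\<Sum>x | x ^ d = c. x ^ k)"
    by (simp add: power_mult_distrib sum_distrib_left)
  finally show ?thesis using yk by (metis mult_cancel_right1)
qed

text \<open>For \<open>c = 1\<close> this is the subfield of order \<open>Q\<close>, and any other nonzero line is a multiple of it.\<close>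

definition frob_line :: "nat \<Rightarrow> 'a::{field,finite} \<Rightarrow> 'a set" where
  "frob_line Q c = {x. x ^ Q = c * x}"

text \<open>The nonzero points of the line are the Q - 1 solutions of x ^ (Q - 1) = c, on which x ^
  k is constant or sums to zero. The minus sign is Q - 1 read in the field, where Q = 0; for k = 0
  the sum is Q = 0.\<close>

lemma
  fixes x0 :: "'a::{field,finite}"
  assumes Q: "Q \<ge> 2" "of_nat Q = (0::'a)" "(Q - 1) dvd CARD('a) - 1"
    and x0: "x0 \<noteq> 0" "x0 \<in> frob_line Q c"
  shows card_frob_line: "card (frob_line Q c) = Q"
    and sum_power_frob_line: "(\<Sum>x\<in>frob_line Q c. x ^ k) =
           (if k > 0 \<and> (Q - 1) dvd k then - (c ^ (k div (Q - 1))) else 0)"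
proof -
  have pw: "x ^ Q = x * x ^ (Q - 1)" for x :: 'a
    using Q by (cases Q) auto
  have L: "frob_line Q c = insert 0 {x. x ^ (Q - 1) = c}"
    using pw Q by (auto simp: frob_line_def power_0_left)
  have x0': "x0 ^ (Q - 1) = c" using x0 L by auto
  have "c \<noteq> 0" using x0' x0 by auto
  then have n0: "0 \<notin> {x. x ^ (Q - 1) = c}" using Q by (auto simp: power_0_left)
  have cd: "card {x. x ^ (Q - 1) = c} = Q - 1"
    using card_power_eq[OF Q(3) x0(1) x0'] .
  show "card (frob_line Q c) = Q" unfolding L using n0 cd Q by simp
  have m1: "of_nat (Q - 1) = (- 1 :: 'a)" using Q by (simp add: of_nat_diff)
  show "(\<Sum>x\<in>frob_line Q c. x ^ k) =
           (if k > 0 \<and> (Q - 1) dvd k then - (c ^ (k div (Q - 1))) else 0)"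
  proof (cases "(Q - 1) dvd k")
    case True
    then obtain m where m: "k = (Q - 1) * m" by auto
    have "(\<Sum>x | x ^ (Q - 1) = c. x ^ k) = (\<Sum>x | x ^ (Q - 1) = c. c ^ m)"
      by (intro sum.cong) (auto simp: m power_mult)
    also have "\<dots> = - (c ^ m)" by (simp only: sum_constant cd m1) simp
    finally show ?thesis unfolding L using n0 Q m by (auto simp: power_0_left)
  next
    case False
    then have "k > 0" by (auto intro!: Nat.gr0I)
    with False show ?thesis
      unfolding L using n0 sum_power_of_roots[OF Q(3) False, of c] by (simp add: power_0_left)
  qed
qed

section \<open>Third differences over the field with \<open>p ^ 4\<close> elements\<close>

text \<open>Hermite's criterion enters in this form: with \<open>h\<close> a power, the power sum of
  an injective map equals that of its target. Source and target are kept separate because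
  \<open>mixed_type\<close> maps one line onto another.\<close>

lemma sum_inj_into_same_card:
  assumes "finite S'" "inj_on g S" "g ` S \<subseteq> S'" "card S = card S'"
  shows "(\<Sum>x\<in>S. h (g x)) = (\<Sum>y\<in>S'. h y)"
proof -
  have "g ` S = S'" using assms by (metis card_image card_subset_eq)
  then show ?thesis using sum.reindex[OF assms(2), of h] by (simp add: o_def)
qed

text \<open>The third difference in directions 2 * a, 2 * b, 2 * c, recentred at \<open>x\<close>.
  The symmetric form respects parity, and in odd characteristic doubling loses no
  directions.\<close>

definition cdiff :: "('a::comm_ring_1 \<Rightarrow> 'a) \<Rightarrow> 'a \<Rightarrow> 'a \<Rightarrow> 'a \<Rightarrow> 'a \<Rightarrow> 'a" where
  "cdiff f a b c x =
     f (x + a + b + c) - f (x + a + b - c) - f (x + a - b + c) + f (x + a - b - c)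
     - f (x - a + b + c) + f (x - a + b - c) + f (x - a - b + c) - f (x - a - b - c)"

definition PN3 :: "('a::comm_ring_1 \<Rightarrow> 'a) \<Rightarrow> bool" where
  "PN3 f \<longleftrightarrow> (\<forall>a b c. a \<noteq> 0 \<longrightarrow> b \<noteq> 0 \<longrightarrow> c \<noteq> 0 \<longrightarrow> inj (cdiff f a b c))"

lemma PN3_D:
  "PN3 f \<Longrightarrow> a \<noteq> 0 \<Longrightarrow> b \<noteq> 0 \<Longrightarrow> c \<noteq> 0 \<Longrightarrow> cdiff f a b c x = cdiff f a b c y \<Longrightarrow> x = y"
  unfolding PN3_def by (meson injD)

section \<open>Frobenius, subfields and twisted lines\<close>

locale quartic_field =
  fixes p :: nat and ty :: "'a::{field,finite} itself"
  assumes prime_p: "prime p" and p_ge: "p \<ge> 5" and CARD_eq: "CARD('a) = p ^ 4"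
begin

lemma CHAR_eq: "CHAR('a) = p"
proof -
  have "CHAR('a) dvd p ^ 4"
    using of_nat_CARD_eq_0[where 'a='a] unfolding CARD_eq of_nat_eq_0_iff_char_dvd .
  moreover have "prime CHAR('a)" by (intro prime_CHAR_semidom finite_imp_CHAR_pos) auto
  ultimately show ?thesis
    using prime_p by (metis prime_dvd_power primes_dvd_imp_eq)
qed

lemma of_nat_eq_0: "of_nat m = (0::'a) \<longleftrightarrow> p dvd m"
  by (simp add: of_nat_eq_0_iff_char_dvd CHAR_eq)

lemma numeral_neq_0 [simp]: "(2::'a) \<noteq> 0" "(3::'a) \<noteq> 0" "(4::'a) \<noteq> 0"
proof -
  have "\<not> p dvd 2" "\<not> p dvd 3" "\<not> p dvd 4" using p_ge by (auto dest: dvd_imp_le)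
  then have "of_nat 2 \<noteq> (0::'a)" "of_nat 3 \<noteq> (0::'a)" "of_nat 4 \<noteq> (0::'a)"
    unfolding of_nat_eq_0 by auto
  then show "(2::'a) \<noteq> 0" "(3::'a) \<noteq> 0" "(4::'a) \<noteq> 0" by auto
qed

lemma uminus_neq_self: "(x::'a) \<noteq> 0 \<Longrightarrow> - x \<noteq> x"
proof
  assume "x \<noteq> 0" "- x = x"
  then have "2 * x = 0" by (metis add.right_inverse mult_2)
  then show False using \<open>x \<noteq> 0\<close> by simp
qed

lemma odd_p: "odd p"
  using prime_p p_ge by (intro prime_odd_nat) auto

lemma frob_add: "(x + y :: 'a) ^ (p ^ k) = x ^ (p ^ k) + y ^ (p ^ k)"
  by (rule freshmans_dream'[of _ k]) (simp_all add: CHAR_eq prime_p)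

lemma frob_uminus: "(- x :: 'a) ^ (p ^ k) = - (x ^ (p ^ k))"
  by (simp add: odd_p)

lemma frob_diff: "(x - y :: 'a) ^ (p ^ k) = x ^ (p ^ k) - y ^ (p ^ k)"
  using frob_add[of x "- y" k] by (simp add: frob_uminus)

lemma frob_numeral [simp]: "(2::'a) ^ (p ^ k) = 2" "(3::'a) ^ (p ^ k) = 3"
  using frob_add[of 1 1 k] frob_add[of 2 1 k] by simp_all

lemma frob4: "(x::'a) ^ (p ^ 4) = x"
proof (cases "x = 0")
  case True
  then show ?thesis using p_ge by (simp add: power_0_left)
next
  case False
  have "x ^ (p ^ 4) = x * x ^ (p ^ 4 - 1)" using p_ge by (cases "p ^ 4") auto
  then show ?thesis using power_CARD_minus_1[OF False] CARD_eq by simp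
qed

text \<open>The extra factor 2 in the second divisibility, available since p + 1 and p ^ 2 + 1 are
  even, is what produces the elements of \<open>ex_twisted\<close>.\<close>

lemma line_dvd:
  assumes "Q = p \<or> Q = p\<^sup>2"
  shows "Q - 1 dvd CARD('a) - 1" "2 * (Q - 1) dvd CARD('a) - 1" "of_nat Q = (0::'a)" "Q \<ge> 5"
    "Q\<^sup>2 - 1 dvd CARD('a) - 1"
proof -
  obtain r where r: "p = 2 * r + 1" using odd_p by (elim oddE)
  have p1: "int (p ^ 4 - 1) = int p ^ 4 - 1" "int (p\<^sup>2 - 1) = int p ^ 2 - 1" "int (p - 1) = int p - 1"
    using p_ge by (simp_all add: of_nat_diff)
  have Qp: "Q - 1 dvd p ^ 4 - 1 \<and> 2 * (Q - 1) dvd p ^ 4 - 1 \<and> Q\<^sup>2 - 1 dvd p ^ 4 - 1"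
  proof -
    have e1: "int p ^ 4 - 1 = (int p - 1) * ((int p + 1) * (int p ^ 2 + 1))"
      "int p ^ 4 - 1 = (int p ^ 2 - 1) * (int p ^ 2 + 1)"
      by (simp_all add: algebra_simps power2_eq_square power4_eq_xxxx)
    have e2: "int p + 1 = 2 * (int r + 1)" "int p ^ 2 + 1 = 2 * (2 * int r ^ 2 + 2 * int r + 1)"
      using r by (simp_all add: algebra_simps power2_eq_square)
    have "2 * (int p - 1) dvd int p ^ 4 - 1" 
      unfolding e1(1) e2(1) by (rule dvdI[of _ _ "(int r + 1) * (int p ^ 2 + 1)"]) (simp only: mult_ac)
    moreover have "2 * (int p ^ 2 - 1) dvd int p ^ 4 - 1" 
      unfolding e1(2) e2(2) by (rule dvdI[of _ _ "2 * int r ^ 2 + 2 * int r + 1"]) (simp only: mult_ac)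
    ultimately have "2 * (p - 1) dvd p ^ 4 - 1" "2 * (p\<^sup>2 - 1) dvd p ^ 4 - 1"
      unfolding p1[symmetric] by (metis int_dvd_int_iff of_nat_mult of_nat_numeral)+
    moreover have "(p\<^sup>2)\<^sup>2 = p ^ 4" by (simp flip: power_mult)
    ultimately show ?thesis using assms by (auto dest: dvd_mult_right)
  qed
  then show "Q - 1 dvd CARD('a) - 1" "2 * (Q - 1) dvd CARD('a) - 1" "Q\<^sup>2 - 1 dvd CARD('a) - 1"
    by (simp_all add: CARD_eq)
  show "of_nat Q = (0::'a)" using assms by (auto simp: of_nat_eq_0 simp del: of_nat_power)
  have "p \<le> p * p" using p_ge by simp
  then show "Q \<ge> 5" using assms p_ge by (auto simp only: power2_eq_square)
qed

text \<open>There are twice as many roots of unity of exponent 2 * (Q - 1) as of exponent Q - 1, so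
  for some \<open>w\<close> the power w ^ (Q - 1) is the other square root of 1. Together with 1,
  such a \<open>w\<close> spans the field of order Q ^ 2 over the one of order Q.\<close>

lemma ex_twisted:
  assumes "Q = p \<or> Q = p\<^sup>2"
  obtains w :: 'a where "w \<noteq> 0" "w ^ Q = - w"
proof -
  note Q = line_dvd[OF assms]
  have "card {x::'a. x ^ (Q - 1) = 1} < card {x::'a. x ^ (2 * (Q - 1)) = 1}"
    using card_roots_of_unity[OF Q(1)] card_roots_of_unity[OF Q(2)] Q(4) by simp
  then have "\<not> {x::'a. x ^ (2 * (Q - 1)) = 1} \<subseteq> {x. x ^ (Q - 1) = 1}"
    using card_mono[of "{x::'a. x ^ (Q - 1) = 1}"] by (auto simp: not_le[symmetric])
  then obtain w :: 'a where w: "w ^ (2 * (Q - 1)) = 1" "w ^ (Q - 1) \<noteq> 1" by auto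
  then have "(w ^ (Q - 1))\<^sup>2 = 1" by (simp add: power_mult[symmetric] mult.commute)
  with w have "w ^ (Q - 1) = -1" by (simp add: power2_eq_1_iff)
  moreover have "w ^ Q = w * w ^ (Q - 1)" using Q(4) by (cases Q) auto
  moreover have "w \<noteq> 0" using w Q(4) by (auto simp: power_0_left)
  ultimately show ?thesis using that by simp
qed

lemma
  assumes Q: "Q = p \<or> Q = p\<^sup>2"
  shows card_L0: "card (frob_line Q (1::'a)) = Q"
    and card_L1: "card (frob_line Q (-1::'a)) = Q"
    and sum_L0: "(\<Sum>x\<in>frob_line Q (1::'a). x ^ k) = (if k > 0 \<and> (Q - 1) dvd k then -1 else 0)"
    and sum_L1: "(\<Sum>x\<in>frob_line Q (-1::'a). x ^ k) =
                   (if k > 0 \<and> (Q - 1) dvd k then - ((-1) ^ (k div (Q - 1))) else 0)"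
proof -
  note q = line_dvd[OF Q]
  have q2: "Q \<ge> 2" using q by simp
  have one: "(1::'a) \<noteq> 0" "1 \<in> frob_line Q (1::'a)" by (auto simp: frob_line_def)
  obtain w :: 'a where w: "w \<noteq> 0" "w ^ Q = - w" using ex_twisted[OF Q] .
  then have w': "w \<in> frob_line Q (-1)" by (simp add: frob_line_def)
  show "card (frob_line Q (1::'a)) = Q" "card (frob_line Q (-1::'a)) = Q"
    using card_frob_line[OF q2 q(3,1) one] card_frob_line[OF q2 q(3,1) w(1) w'] .
  show "(\<Sum>x\<in>frob_line Q (1::'a). x ^ k) = (if k > 0 \<and> (Q - 1) dvd k then -1 else 0)"
    using sum_power_frob_line[OF q2 q(3,1) one] by simp
  show "(\<Sum>x\<in>frob_line Q (-1::'a). x ^ k) =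
                   (if k > 0 \<and> (Q - 1) dvd k then - ((-1) ^ (k div (Q - 1))) else 0)"
    using sum_power_frob_line[OF q2 q(3,1) w(1) w'] .
qed

lemma sum_field:
  assumes Q: "Q = p \<or> Q = p\<^sup>2"
  shows "(\<Sum>x\<in>frob_line (Q\<^sup>2) (1::'a). x ^ k) = (if k > 0 \<and> (Q\<^sup>2 - 1) dvd k then -1 else 0)"
proof -
  note q = line_dvd[OF Q]
  have "Q \<le> Q * Q" using q(4) by simp
  then have ge: "Q\<^sup>2 \<ge> 2" using q(4) by (simp only: power2_eq_square)
  have z: "of_nat (Q\<^sup>2) = (0::'a)" using q(3) by simp
  have one: "(1::'a) \<noteq> 0" "1 \<in> frob_line (Q\<^sup>2) (1::'a)" by (auto simp: frob_line_def)
  show ?thesis using sum_power_frob_line[OF ge z q(5) one, of k] by simp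
qed

section \<open>First constraints on the exponent\<close>

text \<open>Frobenius is additive and injective, so it can be applied to the whole third difference.
  Modulo p ^ 4 - 1, multiplying n by p rotates its base-p digits.\<close>

lemma PN3_shift:
  assumes "PN3 (\<lambda>x::'a. x ^ n)"
  shows "PN3 (\<lambda>x::'a. x ^ (p * n))"
proof -
  have inj: "x = y" if "x ^ p = y ^ p" for x y :: 'a
  proof -
    have "(x - y) ^ p = 0" using frob_diff[of x y 1] that by simp
    then show ?thesis by simp
  qed
  have "cdiff (\<lambda>x::'a. x ^ (p * n)) a b c x = (cdiff (\<lambda>x. x ^ n) a b c x) ^ p" for a b c x
    using frob_add[of _ _ 1] frob_diff[of _ _ 1]
    by (simp add: cdiff_def power_mult[symmetric] mult.commute)
  then show ?thesis
    unfolding PN3_def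
    using PN3_D[OF assms] inj by (intro allI impI injI) metis
qed

text \<open>The centred third difference of an odd function is even, so it takes the same value at 1
  and -1.\<close>

lemma PN3_even:
  assumes "PN3 (\<lambda>x::'a. x ^ n)"
  shows "even n"
proof (rule ccontr)
  assume o: "odd n"
  have m: "(- x) ^ n = - (x ^ n)" for x :: 'a using o by simp
  have "cdiff (\<lambda>x::'a. x ^ n) 1 1 1 (-1) = cdiff (\<lambda>x::'a. x ^ n) 1 1 1 1"
    using m[of 4] m[of 2] m[of 1] odd_pos[OF o] by (simp add: cdiff_def power_0_left)
  then have "(-1::'a) = 1" using PN3_D[OF assms, of 1 1 1] by simp
  then show False using uminus_neq_self[of 1] by simp
qed

text \<open>In coordinates z = s + t * w with s, t in the field of order Q, the function is the
  binary quartic form \<open>h\<close>, since z ^ Q = s - t * w. A third difference of a quartic is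
  affine, and its slope along \<open>w\<close> is a multiple of one coefficient: that of s^2 * t^2
  for directions 1, 1, w and that of s^3 * t for 1, 1, 1.\<close>

lemma weight_four:
  assumes Q: "Q = p \<or> Q = p\<^sup>2" and PN: "PN3 (\<lambda>x::'a. x ^ n)"
    and f: "\<And>x::'a. x ^ (Q\<^sup>2) = x \<Longrightarrow> x ^ n = x ^ A * (x ^ Q) ^ B"
    and AB: "A + B = 4" "A > 0" "B > 0"
  shows False
proof -
  obtain w :: 'a where w: "w \<noteq> 0" "w ^ Q = - w" using ex_twisted[OF Q] .
  obtain k where k: "Q = p ^ k" using Q by (metis power_one_right)
  define h where "h s t = (s + t * w) ^ A * (s - t * w) ^ B" for s t
  have pt: "x ^ n = h s t" if "x = s + t * w" "s ^ Q = s" "t ^ Q = t" for x s t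
  proof -
    have xQ: "x ^ Q = s - t * w"
      using frob_add[of s "t * w" k] that w k by (simp add: power_mult_distrib)
    have "x ^ (Q\<^sup>2) = (x ^ Q) ^ Q" by (simp add: power_mult power2_eq_square)
    also have "\<dots> = x" unfolding xQ
      using frob_diff[of s "t * w" k] that w k by (simp add: power_mult_distrib)
    finally show ?thesis using f[of x] xQ that by (simp add: h_def)
  qed
  have num: "(0::'a) ^ Q = 0" "(1::'a) ^ Q = 1" "(2::'a) ^ Q = 2" "(3::'a) ^ Q = 3"
     "(-1::'a) ^ Q = -1" "(-2::'a) ^ Q = -2" "(-3::'a) ^ Q = -3"
    using frob_uminus[of 1 k] frob_uminus[of 2 k] frob_uminus[of 3 k] k p_ge by auto
  have ne: "- w \<noteq> w" using w uminus_neq_self by simp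
  have pts11w:
    "(w + 1 + 1 + w) ^ n = h 2 2" "(w + 1 + 1 - w) ^ n = h 2 0"
    "(w + 1 - 1 + w) ^ n = h 0 2" "(w + 1 - 1 - w) ^ n = h 0 0"
    "(w - 1 + 1 + w) ^ n = h 0 2" "(w - 1 + 1 - w) ^ n = h 0 0"
    "(w - 1 - 1 + w) ^ n = h (-2) 2" "(w - 1 - 1 - w) ^ n = h (-2) 0"
    "(- w + 1 + 1 + w) ^ n = h 2 0" "(- w + 1 + 1 - w) ^ n = h 2 (-2)"
    "(- w + 1 - 1 + w) ^ n = h 0 0" "(- w + 1 - 1 - w) ^ n = h 0 (-2)"
    "(- w - 1 + 1 + w) ^ n = h 0 0" "(- w - 1 + 1 - w) ^ n = h 0 (-2)"
    "(- w - 1 - 1 + w) ^ n = h (-2) 0" "(- w - 1 - 1 - w) ^ n = h (-2) (-2)"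
    by (rule pt; simp add: num)+
  have pts111:
    "(w + 1 + 1 + 1) ^ n = h 3 1" "(w + 1 + 1 - 1) ^ n = h 1 1"
    "(w + 1 - 1 + 1) ^ n = h 1 1" "(w + 1 - 1 - 1) ^ n = h (-1) 1"
    "(w - 1 + 1 + 1) ^ n = h 1 1" "(w - 1 + 1 - 1) ^ n = h (-1) 1"
    "(w - 1 - 1 + 1) ^ n = h (-1) 1" "(w - 1 - 1 - 1) ^ n = h (-3) 1"
    "(- w + 1 + 1 + 1) ^ n = h 3 (-1)" "(- w + 1 + 1 - 1) ^ n = h 1 (-1)"
    "(- w + 1 - 1 + 1) ^ n = h 1 (-1)" "(- w + 1 - 1 - 1) ^ n = h (-1) (-1)"
    "(- w - 1 + 1 + 1) ^ n = h 1 (-1)" "(- w - 1 + 1 - 1) ^ n = h (-1) (-1)"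
    "(- w - 1 - 1 + 1) ^ n = h (-1) (-1)" "(- w - 1 - 1 - 1) ^ n = h (-3) (-1)"
    by (rule pt; simp add: num)+
  have d11w: "cdiff (\<lambda>x::'a. x ^ n) 1 1 w w = h 2 2 - h 2 0 - h 0 2 + h 0 0 - h 0 2 + h 0 0 + h (-2) 2 - h (-2) 0"
    "cdiff (\<lambda>x::'a. x ^ n) 1 1 w (- w) = h 2 0 - h 2 (-2) - h 0 0 + h 0 (-2) - h 0 0 + h 0 (-2) + h (-2) 0 - h (-2) (-2)"
    unfolding cdiff_def pts11w by (rule refl)+
  have d111: "cdiff (\<lambda>x::'a. x ^ n) 1 1 1 w = h 3 1 - h 1 1 - h 1 1 + h (-1) 1 - h 1 1 + h (-1) 1 + h (-1) 1 - h (-3) 1"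
    "cdiff (\<lambda>x::'a. x ^ n) 1 1 1 (- w) = h 3 (-1) - h 1 (-1) - h 1 (-1) + h (-1) (-1) - h 1 (-1) + h (-1) (-1) + h (-1) (-1) - h (-3) (-1)"
    unfolding cdiff_def pts111 by (rule refl)+
  \<comment> \<open>The form has no s^2 * t^2 term for exponents 1 and 3, and no s^3 * t term for
    exponents 2 and 2; this dictates the directions in each case.\<close>
  consider "A = 1" "B = 3" | "A = 3" "B = 1" | "A = 2" "B = 2" using AB by linarith
  then show False
  proof cases
    case 1
    have "cdiff (\<lambda>x::'a. x ^ n) 1 1 w w = cdiff (\<lambda>x::'a. x ^ n) 1 1 w (- w)"
      unfolding d11w h_def 1 by algebra
    then show False using PN3_D[OF PN _ _ w(1), of 1 1] ne by force
  next
    case 2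
    have "cdiff (\<lambda>x::'a. x ^ n) 1 1 w w = cdiff (\<lambda>x::'a. x ^ n) 1 1 w (- w)"
      unfolding d11w h_def 2 by algebra
    then show False using PN3_D[OF PN _ _ w(1), of 1 1] ne by force
  next
    case 3
    have "cdiff (\<lambda>x::'a. x ^ n) 1 1 1 w = cdiff (\<lambda>x::'a. x ^ n) 1 1 1 (- w)"
      unfolding d111 h_def 3 by algebra
    then show False using PN3_D[OF PN, of 1 1 1] ne by force
  qed
qed

end

section \<open>Exponents of norm type\<close>

text \<open>For u = G and v = G ^ Q the value at 0 is the power sum of G ^ (1 + Q) that Hermite's
  criterion controls.\<close>

definition corr :: "'a set \<Rightarrow> ('a::comm_ring_1 \<Rightarrow> 'a) \<Rightarrow> ('a \<Rightarrow> 'a) \<Rightarrow> 'a \<Rightarrow> 'a" where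
  "corr S u v d = (\<Sum>z\<in>S. u z * v (z + d))"

text \<open>Translating the summation variable moves both differences onto the argument
  \<open>d\<close>, where they become the negative of a second difference with step 2 * a. Hence
  only the correlation of the undifferenced functions has to be computed.\<close>

lemma corr_central_difference:
  fixes a :: "'a::comm_ring_1"
  assumes S: "\<And>x y. x \<in> S \<Longrightarrow> y \<in> S \<Longrightarrow> x + y \<in> S" "\<And>x. x \<in> S \<Longrightarrow> - x \<in> S" and a: "a \<in> S"
  shows "corr S (\<lambda>x. u (x + a) - u (x - a)) (\<lambda>x. v (x + a) - v (x - a)) d =
    2 * corr S u v d - corr S u v (d + 2 * a) - corr S u v (d - 2 * a)"
proof -
  have D: "x - y \<in> S" if "x \<in> S" "y \<in> S" for x y using S(1)[OF that(1) S(2)[OF that(2)]] by simp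
  have plus: "(\<Sum>z\<in>S. u (z + a) * v' z) = (\<Sum>z\<in>S. u z * v' (z - a))"
    and minus: "(\<Sum>z\<in>S. u (z - a) * v' z) = (\<Sum>z\<in>S. u z * v' (z + a))" for v'
    by (rule sum.reindex_bij_witness[of _ "\<lambda>z. z - a" "\<lambda>z. z + a"];
        use S(1)[OF _ a] D[OF _ a] in simp)
      (rule sum.reindex_bij_witness[of _ "\<lambda>z. z + a" "\<lambda>z. z - a"];
        use S(1)[OF _ a] D[OF _ a] in simp)
  have "corr S (\<lambda>x. u (x + a) - u (x - a)) (\<lambda>x. v (x + a) - v (x - a)) d =
    (\<Sum>z\<in>S. u (z + a) * v (z + d + a)) - (\<Sum>z\<in>S. u (z + a) * v (z + d - a))
    - (\<Sum>z\<in>S. u (z - a) * v (z + d + a)) + (\<Sum>z\<in>S. u (z - a) * v (z + d - a))"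
    by (simp add: corr_def algebra_simps sum.distrib sum_subtractf)
  also have "\<dots> = 2 * corr S u v d - corr S u v (d + 2 * a) - corr S u v (d - 2 * a)"
    unfolding plus minus corr_def by (simp add: algebra_simps)
  finally show ?thesis .
qed

lemma double_sum_delta:
  fixes T :: "nat \<Rightarrow> nat \<Rightarrow> 'a::comm_ring_1"
  assumes "a \<le> A" "b \<le> B"
  shows "(\<Sum>i\<le>A. \<Sum>j\<le>B. T i j * (if i = a \<and> j = b then c else 0)) = T a b * c"
proof -
  have "(\<Sum>i\<le>A. \<Sum>j\<le>B. T i j * (if i = a \<and> j = b then c else 0)) =
    (\<Sum>i\<le>A. if i = a then T i b * c else 0)"
  proof (intro sum.cong refl)
    fix i
    show "(\<Sum>j\<le>B. T i j * (if i = a \<and> j = b then c else 0)) = (if i = a then T i b * c else 0)"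
    proof (cases "i = a")
      case True
      have "(\<Sum>j\<le>B. T i j * (if i = a \<and> j = b then c else 0)) = (\<Sum>j\<le>B. if j = b then T i j * c else 0)"
        using True by (intro sum.cong) auto
      then show ?thesis using True assms by simp
    qed simp
  qed
  then show ?thesis using assms by simp
qed

text \<open>For \<open>s\<close> fixed by the Q-th power and w ^ Q = - w, the norm d * d ^ Q of d =
  s + 2 * w is (s + 2 * w) * (s - 2 * w). The identity is thus the effect of the direction
  \<open>w\<close> on the fourth power of the norm.\<close>

lemma central_difference_norm_power4:
  fixes s w :: "'a::comm_ring_1"
  shows "2 * (s * s) ^ 4 - ((s + 2 * w) * (s - 2 * w)) ^ 4 - ((s - 2 * w) * (s + 2 * w)) ^ 4 =
    32 * s ^ 6 * w\<^sup>2 - 192 * s ^ 4 * w ^ 4 + 512 * s\<^sup>2 * w ^ 6 - 512 * w ^ 8"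
  by (simp add: algebra_simps eval_nat_numeral)

text \<open>This applies the two remaining directions, b and 1, to the outcome of
  \<open>central_difference_norm_power4\<close> and evaluates at 0.\<close>

lemma central_differences_norm_power4:
  fixes h :: "'a::comm_ring_1 \<Rightarrow> 'a" and b w :: 'a
  defines "h \<equiv> \<lambda>s. 32 * s ^ 6 * w\<^sup>2 - 192 * s ^ 4 * w ^ 4 + 512 * s\<^sup>2 * w ^ 6 - 512 * w ^ 8"
  shows "2 * (2 * h 0 - h (0 + 2 * b) - h (0 - 2 * b))
      - (2 * h (0 + 2) - h (0 + 2 + 2 * b) - h (0 + 2 - 2 * b))
      - (2 * h (0 - 2) - h (0 - 2 + 2 * b) - h (0 - 2 - 2 * b)) =
    24576 * b\<^sup>2 * w\<^sup>2 * (5 * (1 + b\<^sup>2) - 3 * w\<^sup>2)"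
  unfolding h_def by (simp add: algebra_simps eval_nat_numeral)

text \<open>The bounds give u + Q * v at most (Q + 1) * (Q + 3), so the quotient by Q ^ 2 - 1 is 1
  or 2. Quotient 2 needs 2 * (Q - 1) to be at most Q + 3, hence Q = 5; for quotient 1 the residue
  modulo Q determines u.\<close>

lemma norm_exponent_dvd_iff:
  fixes Q u v :: nat
  assumes Q: "Q \<ge> 5" and uv: "4 \<le> u" "u \<le> Q + 3" "4 \<le> v" "v \<le> Q + 3"
  shows "(Q\<^sup>2 - 1) dvd (u + Q * v) \<longleftrightarrow> (u = Q - 1 \<and> v = Q - 1) \<or> (Q = 5 \<and> u = 8 \<and> v = 8)"
proof
  assume "(Q\<^sup>2 - 1) dvd (u + Q * v)"
  then obtain k where k: "u + Q * v = (Q\<^sup>2 - 1) * k" by auto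
  obtain m where m: "Q = m + 5" using Q by (metis add.commute le_Suc_ex)
  have Q2: "Q\<^sup>2 - 1 = (Q + 1) * (Q - 1)" by (simp add: m power2_eq_square algebra_simps)
  have "u + Q * v \<le> (Q + 1) * (Q + 3)"
    using uv mult_left_mono[of v "Q + 3" Q] by (simp add: algebra_simps)
  then have "(Q + 1) * ((Q - 1) * k) \<le> (Q + 1) * (Q + 3)" 
    using k unfolding Q2 by (simp only: mult.assoc)
  then have le: "(Q - 1) * k \<le> Q + 3" by (subst (asm) mult_le_cancel1) simp
  have "k \<noteq> 0"
  proof
    assume "k = 0"
    with k uv show False by simp
  qed
  have "k \<le> 2"
  proof (rule ccontr)
    assume "\<not> k \<le> 2"
    then have "(Q - 1) * 3 \<le> (Q - 1) * k" by (intro mult_left_mono) auto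
    from this le have "(Q - 1) * 3 \<le> Q + 3" by (rule le_trans)
    with Q show False by simp
  qed
  with \<open>k \<noteq> 0\<close> consider "k = 1" | "k = 2" by linarith
  then show "(u = Q - 1 \<and> v = Q - 1) \<or> (Q = 5 \<and> u = 8 \<and> v = 8)"
  proof cases
    case 1
    then have e: "u + 1 + Q * v = Q * Q" using k Q by (simp add: power2_eq_square algebra_simps m)
    then have "Q dvd u + 1" by (metis dvd_add_left_iff dvd_triv_left)
    then obtain t where t: "u + 1 = Q * t" by auto
    have "t = 1"
    proof (rule ccontr)
      assume "t \<noteq> 1"
      then have "t = 0 \<or> 2 \<le> t" by auto
      then show False
      proof
        assume "2 \<le> t"
        then have "Q * 2 \<le> Q * t" by (intro mult_left_mono) auto
        with t uv Q show False by simp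
      qed (use t in simp)
    qed
    then have "u + 1 = Q" using t by simp
    with e have "Q * (v + 1) = Q * Q" by simp
    then have "v + 1 = Q" using Q by (simp only: mult_cancel1) simp
    with \<open>u + 1 = Q\<close> show ?thesis by auto
  next
    case 2
    with le Q have "Q = 5" by simp
    with k 2 uv show ?thesis by simp
  qed
next
  assume "(u = Q - 1 \<and> v = Q - 1) \<or> (Q = 5 \<and> u = 8 \<and> v = 8)"
  then show "(Q\<^sup>2 - 1) dvd (u + Q * v)"
  proof
    assume "u = Q - 1 \<and> v = Q - 1"
    then have "u + Q * v = Q\<^sup>2 - 1" using Q by (cases Q) (auto simp: power2_eq_square algebra_simps)
    then show ?thesis by simp
  qed simp
qed

context quartic_field
begin

text \<open>The extra constant for \<open>Q = 5\<close> comes from \<open>A = B = 4\<close>; it is killed by the differences taken in \<open>norm_type\<close>.\<close>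

lemma corr_norm:
  fixes A B :: nat
  assumes Q: "Q = p \<or> Q = p\<^sup>2"
    and f: "\<And>x::'a. x ^ (Q\<^sup>2) = x \<Longrightarrow> x ^ n = x ^ A * (x ^ Q) ^ B"
    and AB: "A + B = Q + 3" "4 \<le> A" "4 \<le> B" and d: "d \<in> frob_line (Q\<^sup>2) (1::'a)"
  shows "corr (frob_line (Q\<^sup>2) (1::'a)) (\<lambda>x. x ^ n) (\<lambda>x. (x ^ n) ^ Q) d =
     - of_nat (A choose (Q - 1 - B)) * of_nat (B choose (Q - 1 - A)) * (d * d ^ Q) ^ 4
     + (if Q = 5 then - 1 else 0)"
proof -
  let ?K = "frob_line (Q\<^sup>2) (1::'a)"
  note q = line_dvd[OF Q]
  obtain k where k: "Q = p ^ k" using Q by (metis power_one_right)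
  have fr: "(x + y) ^ Q = x ^ Q + y ^ Q" for x y :: 'a using frob_add k by simp
  define T where "T i j = of_nat (A choose i) * of_nat (B choose j) * (d ^ Q) ^ (A - i) * d ^ (B - j)" for i j
  have z: "z ^ n * ((z + d) ^ n) ^ Q = (\<Sum>i\<le>A. \<Sum>j\<le>B. T i j * z ^ ((A + j) + Q * (B + i)))"
    if "z \<in> ?K" for z
  proof -
    have zK: "z ^ (Q\<^sup>2) = z" "d ^ (Q\<^sup>2) = d" using that d by (auto simp: frob_line_def)
    have xx: "(x ^ Q) ^ Q = x ^ (Q\<^sup>2)" for x :: 'a by (simp add: power_mult power2_eq_square)
    have zd: "(z + d) ^ (Q\<^sup>2) = z + d" using zK by (simp add: xx[symmetric] fr)
    have "((z + d) ^ n) ^ Q = ((z + d) ^ Q) ^ A * (((z + d) ^ Q) ^ Q) ^ B"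
      unfolding f[OF zd] by (simp add: power_mult_distrib power_mult[symmetric] mult.commute mult.left_commute)
    also have "\<dots> = (z ^ Q + d ^ Q) ^ A * (z + d) ^ B"
      unfolding fr xx zK ..
    also have "\<dots> = (\<Sum>i\<le>A. of_nat (A choose i) * (z ^ Q) ^ i * (d ^ Q) ^ (A - i)) *
        (\<Sum>j\<le>B. of_nat (B choose j) * z ^ j * d ^ (B - j))"
      unfolding binomial_ring ..
    finally have "z ^ n * ((z + d) ^ n) ^ Q = z ^ A * (z ^ Q) ^ B *
       ((\<Sum>i\<le>A. of_nat (A choose i) * (z ^ Q) ^ i * (d ^ Q) ^ (A - i)) *
        (\<Sum>j\<le>B. of_nat (B choose j) * z ^ j * d ^ (B - j)))"
      using f[OF zK(1)] by simp
    also have "\<dots> = z ^ A * (z ^ Q) ^ B * (\<Sum>i\<le>A. \<Sum>j\<le>B.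
        (of_nat (A choose i) * (z ^ Q) ^ i * (d ^ Q) ^ (A - i)) * (of_nat (B choose j) * z ^ j * d ^ (B - j)))"
      unfolding sum_product ..
    also have "\<dots> = (\<Sum>i\<le>A. \<Sum>j\<le>B. T i j * z ^ ((A + j) + Q * (B + i)))"
      unfolding sum_distrib_left T_def
      by (intro sum.cong refl) (simp add: power_add power_mult mult_ac)
    finally show ?thesis .
  qed
  have "corr ?K (\<lambda>x. x ^ n) (\<lambda>x. (x ^ n) ^ Q) d =
     (\<Sum>z\<in>?K. \<Sum>i\<le>A. \<Sum>j\<le>B. T i j * z ^ ((A + j) + Q * (B + i)))"
    unfolding corr_def by (intro sum.cong refl z)
  also have "\<dots> = (\<Sum>i\<le>A. \<Sum>z\<in>?K. \<Sum>j\<le>B. T i j * z ^ ((A + j) + Q * (B + i)))"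
    by (rule sum.swap)
  also have "\<dots> = (\<Sum>i\<le>A. \<Sum>j\<le>B. \<Sum>z\<in>?K. T i j * z ^ ((A + j) + Q * (B + i)))"
    by (intro sum.cong refl sum.swap)
  also have "\<dots> = (\<Sum>i\<le>A. \<Sum>j\<le>B. T i j * (if i = Q - 1 - B \<and> j = Q - 1 - A then - 1 else 0)
      + T i j * (if i = A \<and> j = B then (if Q = 5 then - 1 else 0) else 0))"
  proof (intro sum.cong refl)
    fix i j assume ij: "i \<in> {..A}" "j \<in> {..B}"
    \<comment> \<open>Both A + j and B + i lie between 4 and Q + 3, so at most two pairs (i, j)
      survive the summation over the field.\<close>
    have "(Q\<^sup>2 - 1) dvd ((A + j) + Q * (B + i)) \<longleftrightarrow>
       (A + j = Q - 1 \<and> B + i = Q - 1) \<or> (Q = 5 \<and> A + j = 8 \<and> B + i = 8)"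
      by (rule norm_exponent_dvd_iff) (use q AB ij in auto)
    also have "\<dots> \<longleftrightarrow> (i = Q - 1 - B \<and> j = Q - 1 - A) \<or> (Q = 5 \<and> i = A \<and> j = B)"
      using AB ij q by auto
    finally have iff: "(Q\<^sup>2 - 1) dvd ((A + j) + Q * (B + i)) \<longleftrightarrow>
      (i = Q - 1 - B \<and> j = Q - 1 - A) \<or> (Q = 5 \<and> i = A \<and> j = B)" .
    have pos: "(A + j) + Q * (B + i) > 0" using AB by simp
    have excl: "\<not> ((i = Q - 1 - B \<and> j = Q - 1 - A) \<and> (Q = 5 \<and> i = A \<and> j = B))"
      using AB by linarith
    have "(\<Sum>z\<in>?K. T i j * z ^ ((A + j) + Q * (B + i))) =
       T i j * (if (i = Q - 1 - B \<and> j = Q - 1 - A) \<or> (Q = 5 \<and> i = A \<and> j = B) then - 1 else 0)"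
      unfolding sum_distrib_left[symmetric] sum_field[OF Q] iff using pos by (simp only: simp_thms)
    also have "\<dots> = T i j * (if i = Q - 1 - B \<and> j = Q - 1 - A then - 1 else 0)
      + T i j * (if i = A \<and> j = B then (if Q = 5 then - 1 else 0) else 0)"
    proof (cases "i = Q - 1 - B \<and> j = Q - 1 - A")
      case True
      with excl show ?thesis by (simp only: simp_thms if_True if_False) auto
    next
      case False
      then show ?thesis by (simp only: simp_thms if_False) (simp only: if_distrib mult_zero_right add_0_left split: if_split; blast)
    qed
    finally show "(\<Sum>z\<in>?K. T i j * z ^ ((A + j) + Q * (B + i))) =
      T i j * (if i = Q - 1 - B \<and> j = Q - 1 - A then - 1 else 0)
      + T i j * (if i = A \<and> j = B then (if Q = 5 then - 1 else 0) else 0)" .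
  qed
  also have "\<dots> = T (Q - 1 - B) (Q - 1 - A) * (- 1) + T A B * (if Q = 5 then - 1 else 0)"
    unfolding sum.distrib using AB q
    by (subst (1 2) double_sum_delta) auto
  also have "\<dots> = - of_nat (A choose (Q - 1 - B)) * of_nat (B choose (Q - 1 - A)) * (d * d ^ Q) ^ 4
     + (if Q = 5 then - 1 else 0)"
  proof -
    \<comment> \<open>Since A + B = Q + 3, both exponents left on the shift are 4; this is the
      origin of the fourth power of the norm.\<close>
    have "A - (Q - 1 - B) = 4" "B - (Q - 1 - A) = 4" if "B \<le> Q - 1" "A \<le> Q - 1"
      using AB q that by auto
    moreover have "B \<le> Q - 1" "A \<le> Q - 1" using AB by auto
    ultimately show ?thesis by (simp add: T_def power_mult_distrib algebra_simps)
  qed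
  finally show ?thesis .
qed

text \<open>A special case of Lucas's theorem: in (k + 1) * (a choose (k + 1)) = (a - k) * (a choose
  k) no factor p appears on the right while k < a mod p.\<close>

lemma not_dvd_binomial_mod:
  assumes "k \<le> a mod p"
  shows "\<not> p dvd (a choose k)"
  using assms
proof (induction k)
  case 0
  then show ?case using p_ge by simp
next
  case (Suc k)
  show ?case
  proof
    assume "p dvd (a choose Suc k)"
    then have "p dvd Suc k * (a choose Suc k)" by (rule dvd_mult)
    then have "p dvd (a - k) * (a choose k)" by (simp only: binomial_absorption binomial_absorb_comp)
    then have "p dvd a - k" using Suc prime_p by (auto simp: prime_dvd_mult_iff)
    moreover have "k \<le> a" using Suc.prems mod_less_eq_dividend[of a p] by linarith
    ultimately have "a mod p = k mod p" by (simp add: mod_eq_dvd_iff_nat)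
    also have "\<dots> \<le> k" by simp
    finally show False using Suc.prems by simp
  qed
qed

lemma not_dvd_binomial: "a < p \<Longrightarrow> k \<le> a \<Longrightarrow> \<not> p dvd (a choose k)"
  by (simp add: not_dvd_binomial_mod)

text \<open>Hermite's criterion with exponent 1 + Q for the directions 1, b, w makes 5 * (1 + b^2) -
  3 * w^2 vanish. Taking b = 1 and b = 2 gives 15 = 0, so p = 5; there the case b = 1 reads 3 * w^2
  = 0.\<close>

lemma norm_type:
  fixes A B :: nat
  assumes Q: "Q = p \<or> Q = p\<^sup>2" and PN: "PN3 (\<lambda>x::'a. x ^ n)"
    and f: "\<And>x::'a. x ^ (Q\<^sup>2) = x \<Longrightarrow> x ^ n = x ^ A * (x ^ Q) ^ B"
    and sumAB: "A + B = Q + 3" and modAB: "4 \<le> A mod p" "4 \<le> B mod p"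
  shows False
proof -
  have AB: "A + B = Q + 3" "4 \<le> A" "4 \<le> B"
    using sumAB modAB mod_less_eq_dividend[of A p] mod_less_eq_dividend[of B p] by linarith+
  \<comment> \<open>By symmetry both binomials have lower entry 4, and they are prime to p because
    the last base-p digits of A and B are at least 4.\<close>
  have "A - (Q - 1 - B) = 4" "B - (Q - 1 - A) = 4" "Q - 1 - B \<le> A" "Q - 1 - A \<le> B" using AB by linarith+
  then have "A choose (Q - 1 - B) = A choose 4" "B choose (Q - 1 - A) = B choose 4"
    using binomial_symmetric[of "Q - 1 - B" A] binomial_symmetric[of "Q - 1 - A" B] by simp_all
  then have ch: "\<not> p dvd (A choose (Q - 1 - B))" "\<not> p dvd (B choose (Q - 1 - A))"
    using modAB by (simp_all add: not_dvd_binomial_mod)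
  let ?K = "frob_line (Q\<^sup>2) (1::'a)"
  note q = line_dvd[OF Q]
  obtain k where k: "Q = p ^ k" using Q by (metis power_one_right)
  have fr: "(x + y) ^ Q = x ^ Q + y ^ Q" "(x - y) ^ Q = x ^ Q - y ^ Q" "(- x) ^ Q = - (x ^ Q)"
    for x y :: 'a using frob_add frob_diff frob_uminus k by simp_all
  have xx: "x ^ (Q\<^sup>2) = (x ^ Q) ^ Q" for x :: 'a by (simp add: power_mult power2_eq_square)
  have K1: "x + y \<in> ?K" "x - y \<in> ?K" "x * y \<in> ?K" if "x \<in> ?K" "y \<in> ?K" for x y
    using that by (simp_all add: frob_line_def xx fr power_mult_distrib)
  have K2: "- x \<in> ?K" "x ^ m \<in> ?K" if "x \<in> ?K" for x m
  proof -
    have "(x ^ m) ^ (Q\<^sup>2) = (x ^ (Q\<^sup>2)) ^ m" by (simp only: power_mult[symmetric] mult.commute)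
    then show "- x \<in> ?K" "x ^ m \<in> ?K" using that by (simp_all add: frob_line_def xx fr)
  qed
  have K0: "0 \<in> ?K" using q by (simp add: frob_line_def)
  note K = K0 K1 K2
  obtain w :: 'a where w: "w \<noteq> 0" "w ^ Q = - w" using ex_twisted[OF Q] .
  have num: "(1::'a) ^ Q = 1" "(2::'a) ^ Q = 2" using k by simp_all
  have wK: "w \<in> ?K" "1 \<in> ?K" "2 \<in> ?K" using w num by (simp_all add: frob_line_def xx fr)
  define \<kappa> where "\<kappa> = - of_nat (A choose (Q - 1 - B)) * (of_nat (B choose (Q - 1 - A)) :: 'a)"
  define \<kappa>0 where "\<kappa>0 = (if Q = 5 then - 1 else (0 :: 'a))"
  have "\<kappa> \<noteq> 0" using ch by (simp add: \<kappa>_def of_nat_eq_0)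
  let ?f = "\<lambda>x::'a. x ^ n"
  let ?g = "\<lambda>x::'a. (x ^ n) ^ Q"
  have co: "corr ?K ?f ?g d = \<kappa> * (d * d ^ Q) ^ 4 + \<kappa>0" if "d \<in> ?K" for d
    using corr_norm[OF Q f AB that] unfolding \<kappa>_def \<kappa>0_def by simp
  have key: "5 * (1 + b\<^sup>2) - 3 * w\<^sup>2 = 0" if b: "b = 1 \<or> b = 2" for b :: 'a
  proof -
    have bQ: "b ^ Q = b" "b \<noteq> 0" and bK: "b \<in> ?K"
      using b num wK by (elim disjE; simp)+
    let ?G = "cdiff ?f 1 b w"
    have "inj_on ?G ?K" 
      by (rule inj_onI, rule PN3_D[OF PN, of 1 b w]) (use bQ w in simp_all)
    moreover have "?G ` ?K \<subseteq> ?K"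
      unfolding cdiff_def using bK wK by (intro image_subsetI K)
    ultimately have "(\<Sum>z\<in>?K. ?G z ^ (1 + Q)) = (\<Sum>y\<in>?K. y ^ (1 + Q))"
      by (intro sum_inj_into_same_card[of ?K ?G ?K "\<lambda>y. y ^ (1 + Q)"]) auto
    also have "\<dots> = 0"
    proof -
      have "5 * Q \<le> Q * Q" using q by (intro mult_right_mono) auto
      then have le: "5 * Q \<le> Q\<^sup>2" by (simp only: power2_eq_square)
      have "\<not> (Q\<^sup>2 - 1) dvd (1 + Q)"
      proof
        assume "(Q\<^sup>2 - 1) dvd (1 + Q)"
        then have "Q\<^sup>2 - 1 \<le> 1 + Q" by (rule dvd_imp_le) simp
        with le q(4) show False by linarith
      qed
      then show ?thesis unfolding sum_field[OF Q] by simp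
    qed
    finally have sum0: "(\<Sum>z\<in>?K. ?G z ^ (1 + Q)) = 0" .
    define D where "D a u = (\<lambda>x. u (x + a) - u (x - a))" for a and u :: "'a \<Rightarrow> 'a"
    have G: "?G = D 1 (D b (D w ?f))"
      by (rule ext) (simp add: cdiff_def D_def algebra_simps)
    have GQ: "(\<lambda>x. D a u x ^ Q) = D a (\<lambda>x. u x ^ Q)" for a u by (simp add: D_def fr)
    have C: "corr ?K (D a u) (D a v) d = 2 * corr ?K u v d - corr ?K u v (d + 2 * a) - corr ?K u v (d - 2 * a)"
      if "a \<in> ?K" for a u v d
      unfolding D_def by (rule corr_central_difference[OF K1(1) K2(1) that])
    define h where "h s = 32 * s ^ 6 * w\<^sup>2 - 192 * s ^ 4 * w ^ 4 + 512 * s\<^sup>2 * w ^ 6 - 512 * w ^ 8" for s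
    have inner: "corr ?K (D w ?f) (D w ?g) s = \<kappa> * h s" if s: "s ^ Q = s" for s
    proof -
      have sK: "s \<in> ?K" using s by (simp add: frob_line_def xx)
      have "corr ?K (D w ?f) (D w ?g) s = 2 * (\<kappa> * (s * s) ^ 4 + \<kappa>0)
        - (\<kappa> * ((s + 2 * w) * (s - 2 * w)) ^ 4 + \<kappa>0) - (\<kappa> * ((s - 2 * w) * (s + 2 * w)) ^ 4 + \<kappa>0)"
        unfolding C[OF wK(1)] using sK wK by (simp add: co K fr s w num power_mult_distrib)
      also have "\<dots> = \<kappa> * (2 * (s * s) ^ 4 - ((s + 2 * w) * (s - 2 * w)) ^ 4 - ((s - 2 * w) * (s + 2 * w)) ^ 4)"
        by (simp add: algebra_simps)
      finally show ?thesis unfolding central_difference_norm_power4 h_def .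
    qed
    have "(\<lambda>x. ?G x ^ Q) = D 1 (D b (D w ?g))"
      unfolding G GQ ..
    then have "(\<Sum>z\<in>?K. ?G z ^ (1 + Q)) = corr ?K (D 1 (D b (D w ?f))) (D 1 (D b (D w ?g))) 0"
      unfolding corr_def by (simp add: G[symmetric] fun_eq_iff)
    also have "\<dots> = \<kappa> * (2 * (2 * h 0 - h (0 + 2 * b) - h (0 - 2 * b))
      - (2 * h (0 + 2) - h (0 + 2 + 2 * b) - h (0 + 2 - 2 * b))
      - (2 * h (0 - 2) - h (0 - 2 + 2 * b) - h (0 - 2 - 2 * b)))"
      unfolding C[OF wK(2)] C[OF bK] mult_1_right
      using q by (simp add: inner fr num bQ power_mult_distrib algebra_simps)
    also have "\<dots> = \<kappa> * (24576 * b\<^sup>2 * w\<^sup>2 * (5 * (1 + b\<^sup>2) - 3 * w\<^sup>2))"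
      unfolding h_def central_differences_norm_power4 ..
    finally have "\<kappa> * ((2 ^ 13 * 3) * b\<^sup>2 * w\<^sup>2 * (5 * (1 + b\<^sup>2) - 3 * w\<^sup>2)) = 0"
      using sum0 by simp
    \<comment> \<open>This is 24576, written so that only 2 and 3 have to be nonzero.\<close>
    moreover have "(2 ^ 13 * 3 :: 'a) \<noteq> 0" by (simp del: power_numeral)
    ultimately show ?thesis using bQ(2) w(1) \<open>\<kappa> \<noteq> 0\<close> by (simp only: mult_eq_0_iff power_eq_0_iff simp_thms)
  qed
  have "(15::'a) = 0" using key[of 1] key[of 2] by (simp add: algebra_simps)
  then have "of_nat 15 = (0::'a)" by simp
  then have "p dvd 3 * 5" unfolding of_nat_eq_0 by simp
  then have "p dvd 3 \<or> p dvd 5" using prime_p by (simp only: prime_dvd_mult_iff)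
  then have "p = 5" using p_ge by (auto dest: dvd_imp_le)
  then have "of_nat 5 = (0::'a)" unfolding of_nat_eq_0 by simp
  then have "3 * w\<^sup>2 = 0" using key[of 1] by simp
  then show False using w by simp
qed

end

section \<open>Exponents of mixed type\<close>

text \<open>Homogenizing turns the factor X + c into u + c * v. A degree bound \<open>N\<close>
  instead of the exact degree lets the induction in \<open>split_poly_homogenize\<close> run on
  \<open>degree_split_poly\<close> alone.\<close>

lemma homogenize_mult_linear:
  fixes P :: "'a::comm_ring_1 poly"
  assumes "degree P \<le> N"
  shows "(\<Sum>s\<le>Suc N. coeff ([:c, 1:] * P) s * u ^ s * v ^ (Suc N - s)) =
    (u + c * v) * (\<Sum>s\<le>N. coeff P s * u ^ s * v ^ (N - s))"
proof -
  have cf: "coeff ([:c, 1:] * P) s = c * coeff P s + (case s of 0 \<Rightarrow> 0 | Suc t \<Rightarrow> coeff P t)" for s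
    by (simp add: coeff_pCons split: nat.split)
  have top: "coeff P (Suc N) = 0" using assms by (intro coeff_eq_0) auto
  have "(\<Sum>s\<le>Suc N. coeff ([:c, 1:] * P) s * u ^ s * v ^ (Suc N - s)) =
     (\<Sum>s\<le>Suc N. c * coeff P s * u ^ s * v ^ (Suc N - s)) +
     (\<Sum>s\<le>Suc N. (case s of 0 \<Rightarrow> 0 | Suc t \<Rightarrow> coeff P t) * u ^ s * v ^ (Suc N - s))"
    unfolding cf by (simp only: distrib_right sum.distrib)
  also have "(\<Sum>s\<le>Suc N. c * coeff P s * u ^ s * v ^ (Suc N - s)) =
      (\<Sum>s\<le>N. c * coeff P s * u ^ s * v ^ (Suc N - s))"
    using top by simp
  also have "\<dots> = c * v * (\<Sum>s\<le>N. coeff P s * u ^ s * v ^ (N - s))"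
    unfolding sum_distrib_left by (intro sum.cong) (auto simp: Suc_diff_le mult_ac)
  also have "(\<Sum>s\<le>Suc N. (case s of 0 \<Rightarrow> 0 | Suc t \<Rightarrow> coeff P t) * u ^ s * v ^ (Suc N - s)) =
      (\<Sum>s\<le>N. coeff P s * u ^ Suc s * v ^ (N - s))"
    by (subst sum.atMost_Suc_shift) simp
  also have "\<dots> = u * (\<Sum>s\<le>N. coeff P s * u ^ s * v ^ (N - s))"
    unfolding sum_distrib_left by (intro sum.cong) (auto simp: mult_ac)
  finally show ?thesis by (simp add: algebra_simps)
qed

text \<open>Up to the sign (-1) ^ b the coefficients are values of binary Krawtchouk polynomials.
  The product arises on the line z ^ (p ^ 2) = - z, where conjugation negates one summand.\<close>

definition split_poly :: "nat \<Rightarrow> nat \<Rightarrow> 'a::comm_ring_1 poly" where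
  "split_poly a b = [:1, 1:] ^ a * [:- 1, 1:] ^ b"

lemma split_poly_Suc:
  "split_poly (Suc a) b = [:1, 1:] * split_poly a b"
  "split_poly a (Suc b) = [:- 1, 1:] * split_poly a b"
  by (simp_all only: split_poly_def power_Suc mult_ac)

lemma degree_split_poly: "degree (split_poly a b :: 'a::comm_ring_1 poly) \<le> a + b"
proof -
  have "degree (split_poly a b :: 'a poly) \<le> degree ([:1, 1:] ^ a :: 'a poly) + degree ([:- 1, 1:] ^ b :: 'a poly)"
    unfolding split_poly_def by (rule degree_mult_le)
  also have "\<dots> \<le> degree [:1, 1::'a:] * a + degree [:- 1, 1::'a:] * b"
    by (intro add_mono degree_power_le)
  finally show ?thesis by simp
qed

lemma split_poly_homogenize:
  fixes u v :: "'a::comm_ring_1"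
  shows "(u + v) ^ a * (u - v) ^ b = (\<Sum>s\<le>a + b. coeff (split_poly a b) s * u ^ s * v ^ (a + b - s))"
proof (induction a)
  case 0
  show ?case
  proof (induction b)
    case (Suc b)
    show ?case
      using homogenize_mult_linear[OF degree_split_poly[of 0 b, where ?'a = 'a], of "- 1" u v] Suc
      by (simp add: split_poly_Suc)
  qed (simp add: split_poly_def)
next
  case (Suc a)
  show ?case
    using homogenize_mult_linear[OF degree_split_poly[of a b, where ?'a = 'a], of 1 u v] Suc
    by (simp add: split_poly_Suc mult.assoc)
qed

lemma coeff_split_poly:
  "coeff (split_poly a b :: 'a::comm_ring_1 poly) 0 = (- 1) ^ b"
  "coeff (split_poly a b :: 'a::comm_ring_1 poly) 1 = (- 1) ^ b * (of_nat a - of_nat b)"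
  "2 * coeff (split_poly a b :: 'a::comm_ring_1 poly) 2 =
    (- 1) ^ b * ((of_nat a - of_nat b)\<^sup>2 - of_nat (a + b))"
proof -
  have cf: "coeff ([:c, 1:] * P) 0 = c * coeff P 0"
    "coeff ([:c, 1:] * P) 1 = c * coeff P 1 + coeff P 0"
    "coeff ([:c, 1:] * P) 2 = c * coeff P 2 + coeff P 1" for c :: 'a and P
    by (simp_all add: coeff_pCons numeral_2_eq_2)
  have cf2: "2 * coeff ([:c, 1:] * P) 2 = c * (2 * coeff P 2) + 2 * coeff P 1" for c :: 'a and P
    unfolding cf(3) by (simp only: distrib_left mult_ac)
  have sp0: "split_poly 0 0 = (1 :: 'a poly)" by (simp add: split_poly_def)
  have "coeff (split_poly a b :: 'a poly) 0 = (- 1) ^ b \<and>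
    coeff (split_poly a b :: 'a poly) 1 = (- 1) ^ b * (of_nat a - of_nat b) \<and>
    2 * coeff (split_poly a b :: 'a poly) 2 = (- 1) ^ b * ((of_nat a - of_nat b)\<^sup>2 - of_nat (a + b))"
  proof (induction a)
    case 0
    show ?case
    proof (induction b)
      case 0
      then show ?case by (simp add: sp0)
    next
      case (Suc b)
      then have IH: "coeff (split_poly 0 b :: 'a poly) 0 = (- 1) ^ b"
        "coeff (split_poly 0 b :: 'a poly) 1 = (- 1) ^ b * (of_nat 0 - of_nat b)"
        "2 * coeff (split_poly 0 b :: 'a poly) 2 = (- 1) ^ b * ((of_nat 0 - of_nat b)\<^sup>2 - of_nat (0 + b))"
        by blast+
      show ?case unfolding split_poly_Suc(2) cf2 cf(1,2) IH
        by (simp add: power2_eq_square algebra_simps)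
    qed
  next
    case (Suc a)
    then have IH: "coeff (split_poly a b :: 'a poly) 0 = (- 1) ^ b"
      "coeff (split_poly a b :: 'a poly) 1 = (- 1) ^ b * (of_nat a - of_nat b)"
      "2 * coeff (split_poly a b :: 'a poly) 2 = (- 1) ^ b * ((of_nat a - of_nat b)\<^sup>2 - of_nat (a + b))"
      by blast+
    show ?case unfolding split_poly_Suc(1) cf2 cf(1,2) IH
      by (simp add: power2_eq_square algebra_simps)
  qed
  then show "coeff (split_poly a b :: 'a::comm_ring_1 poly) 0 = (- 1) ^ b"
  "coeff (split_poly a b :: 'a::comm_ring_1 poly) 1 = (- 1) ^ b * (of_nat a - of_nat b)"
  "2 * coeff (split_poly a b :: 'a::comm_ring_1 poly) 2 =
    (- 1) ^ b * ((of_nat a - of_nat b)\<^sup>2 - of_nat (a + b))" by auto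
qed

lemma binomial_sum_convolution:
  fixes z d z' d' :: "'a::comm_ring_1"
  shows "(z + d) ^ i * (z' + d') ^ j =
    (\<Sum>x\<le>i. \<Sum>y\<le>j. of_nat (i choose x) * of_nat (j choose y) * z ^ (i - x) * z' ^ (j - y) * (d ^ x * d' ^ y))"
proof -
  have "(d + z) ^ i * (d' + z') ^ j = (\<Sum>x\<le>i. of_nat (i choose x) * d ^ x * z ^ (i - x)) *
     (\<Sum>y\<le>j. of_nat (j choose y) * d' ^ y * z' ^ (j - y))"
    unfolding binomial_ring ..
  also have "\<dots> = (\<Sum>x\<le>i. \<Sum>y\<le>j. of_nat (i choose x) * of_nat (j choose y) * z ^ (i - x) * z' ^ (j - y) * (d ^ x * d' ^ y))"
    unfolding sum_product by (intro sum.cong refl) (simp only: mult_ac)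
  finally show ?thesis by (simp only: add.commute)
qed

section \<open>Hermite's criterion on the line z ^ (p ^ 2) = - z\<close>

context quartic_field
begin

text \<open>\<open>M\<close> is chosen so that summing against \<open>d ^ M\<close> extracts the coefficient of \<open>d ^ (2 + 2 * p)\<close>.\<close>

lemma sum_twisted_extract:
  assumes M: "M + 2 + 2 * p = p\<^sup>2 - 1" and i: "i \<le> 3" and j: "j \<le> p"
  shows "(\<Sum>d\<in>frob_line (p\<^sup>2) (- 1 :: 'a). d ^ M * ((z + d) ^ i * (z' + d ^ p) ^ j)) =
    of_nat (i choose 2) * of_nat (j choose 2) * (z ^ (i - 2) * z' ^ (j - 2))"
proof -
  let ?L = "frob_line (p\<^sup>2) (- 1 :: 'a)"
  define T where "T x y = of_nat (i choose x) * of_nat (j choose y) * z ^ (i - x) * z' ^ (j - y)" for x y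
  have "(\<Sum>d\<in>?L. d ^ M * ((z + d) ^ i * (z' + d ^ p) ^ j)) =
    (\<Sum>d\<in>?L. \<Sum>x\<le>i. \<Sum>y\<le>j. T x y * d ^ (M + x + p * y))"
    unfolding binomial_sum_convolution sum_distrib_left T_def
    by (intro sum.cong refl) (simp only: power_add power_mult, simp only: mult_ac)
  also have "\<dots> = (\<Sum>x\<le>i. \<Sum>d\<in>?L. \<Sum>y\<le>j. T x y * d ^ (M + x + p * y))"
    by (rule sum.swap)
  also have "\<dots> = (\<Sum>x\<le>i. \<Sum>y\<le>j. \<Sum>d\<in>?L. T x y * d ^ (M + x + p * y))"
    by (intro sum.cong refl sum.swap)
  \<comment> \<open>On this line the power sum for exponent p ^ 2 - 1 is - (-1) = 1. No larger
    multiple is reached: the exponent is at most M + 3 + p ^ 2, which is below 2 * (p ^ 2 -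
    1).\<close>
  also have "\<dots> = (\<Sum>x\<le>i. \<Sum>y\<le>j. T x y * (if x = 2 \<and> y = 2 then 1 else 0))"
  proof (intro sum.cong refl)
    fix x y assume xy: "x \<in> {..i}" "y \<in> {..j}"
    have iff: "M + x + p * y > 0 \<and> (p\<^sup>2 - 1) dvd (M + x + p * y) \<longleftrightarrow> x = 2 \<and> y = 2"
    proof
      assume "M + x + p * y > 0 \<and> (p\<^sup>2 - 1) dvd (M + x + p * y)"
      then obtain k where k1: "M + x + p * y = (p\<^sup>2 - 1) * k" and "M + x + p * y > 0" by (elim conjE dvdE)
      then have "k > 0" by (intro Nat.gr0I) simp
      note k = k1 this
      have py: "p * y \<le> p\<^sup>2" using xy j by (simp add: power2_eq_square)
      have "k = 1"
      proof (rule ccontr)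
        assume "k \<noteq> 1"
        with k have "(p\<^sup>2 - 1) * 2 \<le> (p\<^sup>2 - 1) * k" by (intro mult_left_mono) auto
        then have "(p\<^sup>2 - 1) * 2 \<le> M + x + p * y" using k by simp
        then show False using py M xy i p_ge by simp
      qed
      with k M have e: "x + p * y = 2 + p * 2" by simp
      have "x = 2"
      proof -
        have "x mod p = 2 mod p" using arg_cong[OF e, of "\<lambda>t. t mod p"] by (simp only: mod_mult_self2)
        then show ?thesis using xy i p_ge by simp
      qed
      with e show "x = 2 \<and> y = 2" using p_ge by simp
    next
      assume "x = 2 \<and> y = 2"
      moreover have "0 < p\<^sup>2 - 1" using M by simp
      ultimately show "M + x + p * y > 0 \<and> (p\<^sup>2 - 1) dvd (M + x + p * y)" using M by (simp add: mult.commute)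
    qed
    have val: "M + x + p * y = p\<^sup>2 - 1" if "x = 2 \<and> y = 2" using that M by simp
    have "0 < p\<^sup>2 - 1" using M by simp
    then show "(\<Sum>d\<in>?L. T x y * d ^ (M + x + p * y)) = T x y * (if x = 2 \<and> y = 2 then 1 else 0)"
      unfolding sum_distrib_left[symmetric] sum_L1[OF disjI2[OF refl]] iff using val by simp
  qed
  also have "\<dots> = of_nat (i choose 2) * of_nat (j choose 2) * (z ^ (i - 2) * z' ^ (j - 2))"
  proof (cases "2 \<le> i \<and> 2 \<le> j")
    case True
    then show ?thesis by (subst double_sum_delta) (auto simp: T_def mult_ac)
  next
    case False
    then have "(\<Sum>x\<le>i. \<Sum>y\<le>j. T x y * (if x = 2 \<and> y = 2 then 1 else 0)) = 0"
      by (intro sum.neutral ballI) auto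
    moreover have "(of_nat (i choose 2) * of_nat (j choose 2) :: 'a) = 0"
      using False by (auto simp: binomial_eq_0)
    ultimately show ?thesis by (simp only: mult_zero_left)
  qed
  finally show ?thesis .
qed

text \<open>
  For \<open>z\<close> on the line \<open>z ^ p\<^sup>2 = - z\<close> and the directions \<open>2\<close>, \<open>2 * e\<close> in the subfield, the third
  difference permutes that line up to a twist, so only degree \<open>p\<^sup>2\<close> instead of \<open>p ^ 4\<close> has to be
  reached and the exponent \<open>1 + p\<close> in Hermite's criterion is enough. The choice \<open>e ^ p = - e\<close> kills all
  coefficients but one.
\<close>

lemma mixed_type:
  assumes PN: "PN3 (\<lambda>x::'a. x ^ n)"
    and f: "\<And>x::'a. x ^ n = x ^ n0 * (x ^ p) ^ n1 * (x ^ (p\<^sup>2)) ^ n2 * ((x ^ p) ^ (p\<^sup>2)) ^ n3"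
    and dig: "n0 + n2 = 3" "n1 + n3 = p" "n1 > 0" "n3 > 0"
  shows False
proof -
  let ?L = "frob_line (p\<^sup>2) (- 1 :: 'a)" and ?S = "frob_line (p\<^sup>2) (1 :: 'a)"
  note q = line_dvd[OF disjI2[OF refl]]
  have fr: "(x + y) ^ p = x ^ p + y ^ p" "(x - y) ^ p = x ^ p - y ^ p" "(- x) ^ p = - (x ^ p)"
    "(x + y) ^ (p\<^sup>2) = x ^ (p\<^sup>2) + y ^ (p\<^sup>2)" "(x - y) ^ (p\<^sup>2) = x ^ (p\<^sup>2) - y ^ (p\<^sup>2)"
    "(- x) ^ (p\<^sup>2) = - (x ^ (p\<^sup>2))" for x y :: 'a
    using frob_add[of x y 1] frob_add[of x y 2] frob_diff[of x y 1] frob_diff[of x y 2]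
      frob_uminus[of x 1] frob_uminus[of x 2] by simp_all
  have pp: "(x ^ p) ^ p = x ^ (p\<^sup>2)" "(x ^ p) ^ (p\<^sup>2) = (x ^ (p\<^sup>2)) ^ p" for x :: 'a
    by (simp_all only: power_mult[symmetric] power2_eq_square mult.commute mult.left_commute)
  obtain e :: 'a where e: "e \<noteq> 0" "e ^ p = - e" using ex_twisted[of p] by auto
  have eQ: "e ^ (p\<^sup>2) = e" using e by (simp add: pp(1)[symmetric] fr)
  have Lz: "z ^ (p\<^sup>2) = - z" if "z \<in> ?L" for z using that by (simp add: frob_line_def)
  have L1: "x + y \<in> ?L" if "x \<in> ?L" "y \<in> ?L" for x y using that by (simp add: frob_line_def fr)
  have L2: "- x \<in> ?L" if "x \<in> ?L" for x using that by (simp add: frob_line_def fr)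
  have evn: "(- x) ^ n = x ^ n" for x :: 'a using PN3_even[OF PN] by simp
  define J where "J = {..3::nat} \<times> {..p}"
  define h where "h r = (coeff (split_poly n0 n2) r :: 'a)" for r
  define \<kappa> where "\<kappa> s = (coeff (split_poly n1 n3) s :: 'a)" for s
  \<comment> \<open>The signed sum of \<alpha> ^ r * \<beta> ^ s over the four points \<alpha> = 1 +
    e, 1 - e, -1 + e, -1 - e, where \<beta> = \<alpha> ^ p arises by negating e.\<close>
  define A where "A r s = (1 + e) ^ r * (1 - e) ^ s - (1 - e) ^ r * (1 + e) ^ s
    - (- 1 + e) ^ r * (- 1 - e) ^ s + (- 1 - e) ^ r * (- 1 + e) ^ s" for r s :: nat
  have A_even: "A r s = (1 + (- 1) ^ (r + s)) * ((1 + e) ^ r * (1 - e) ^ s - (1 - e) ^ r * (1 + e) ^ s)" for r s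
  proof -
    have m: "(- 1 + e) ^ k = (- 1) ^ k * (1 - e) ^ k" "(- 1 - e) ^ k = (- 1) ^ k * (1 + e) ^ k" for k
      using power_minus[of "1 - e" k] power_minus[of "1 + e" k] by simp_all
    show ?thesis unfolding A_def m power_add by (simp add: algebra_simps)
  qed
  have A_odd: "A r s = 0" if "odd (r + s)" for r s unfolding A_even using that by simp
  have A11: "A 1 1 = 0" unfolding A_even by (simp add: mult.commute)
  \<comment> \<open>Two of the three differences are taken here, with steps 2 and 2 * e; the third,
    along the line itself, is left to the correlation \<open>E\<close>.\<close>
  define Y where "Y v = (v + (1 + e)) ^ n - (v + (1 - e)) ^ n - (v + (- 1 + e)) ^ n + (v + (- 1 - e)) ^ n" for v
  define y where "y k = h (fst k) * \<kappa> (snd k) * A (fst k) (snd k)" for k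
  have expand: "(v + \<alpha>) ^ n = (\<Sum>k\<in>J. h (fst k) * \<kappa> (snd k) * (\<alpha> ^ fst k * \<beta> ^ snd k)
      * (v ^ (3 - fst k) * (v ^ p) ^ (p - snd k)))"
    if v: "v \<in> ?L" and \<alpha>: "\<alpha> ^ p = \<beta>" "\<beta> ^ p = \<alpha>" for v \<alpha> \<beta>
  proof -
    have aQ: "\<alpha> ^ (p\<^sup>2) = \<alpha>" "\<beta> ^ (p\<^sup>2) = \<beta>" using \<alpha> by (simp_all add: pp(1)[symmetric])
    have "(v + \<alpha>) ^ n = (v + \<alpha>) ^ n0 * (v ^ p + \<beta>) ^ n1 * (- v + \<alpha>) ^ n2 * (- (v ^ p) + \<beta>) ^ n3"
      unfolding f[of "v + \<alpha>"] pp(2) fr Lz[OF v] aQ \<alpha>(1) ..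
    also have "\<dots> = ((\<alpha> + v) ^ n0 * (\<alpha> - v) ^ n2) * ((\<beta> + v ^ p) ^ n1 * (\<beta> - v ^ p) ^ n3)"
      by (simp add: mult_ac add.commute)
    also have "\<dots> = (\<Sum>r\<le>3. h r * \<alpha> ^ r * v ^ (3 - r)) * (\<Sum>s\<le>p. \<kappa> s * \<beta> ^ s * (v ^ p) ^ (p - s))"
      unfolding split_poly_homogenize dig h_def \<kappa>_def ..
    also have "\<dots> = (\<Sum>k\<in>J. h (fst k) * \<kappa> (snd k) * (\<alpha> ^ fst k * \<beta> ^ snd k)
      * (v ^ (3 - fst k) * (v ^ p) ^ (p - snd k)))"
      unfolding sum_product sum.cartesian_product J_def
      by (intro sum.cong refl) (simp add: case_prod_beta mult_ac)
    finally show ?thesis .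
  qed
  have Y: "Y v = (\<Sum>k\<in>J. y k * (v ^ (3 - fst k) * (v ^ p) ^ (p - snd k)))" if "v \<in> ?L" for v
  proof -
    have ex: "(v + (1 + e)) ^ n = (\<Sum>k\<in>J. h (fst k) * \<kappa> (snd k) * ((1 + e) ^ fst k * (1 - e) ^ snd k)
        * (v ^ (3 - fst k) * (v ^ p) ^ (p - snd k)))"
      "(v + (1 - e)) ^ n = (\<Sum>k\<in>J. h (fst k) * \<kappa> (snd k) * ((1 - e) ^ fst k * (1 + e) ^ snd k)
        * (v ^ (3 - fst k) * (v ^ p) ^ (p - snd k)))"
      "(v + (- 1 + e)) ^ n = (\<Sum>k\<in>J. h (fst k) * \<kappa> (snd k) * ((- 1 + e) ^ fst k * (- 1 - e) ^ snd k)
        * (v ^ (3 - fst k) * (v ^ p) ^ (p - snd k)))"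
      "(v + (- 1 - e)) ^ n = (\<Sum>k\<in>J. h (fst k) * \<kappa> (snd k) * ((- 1 - e) ^ fst k * (- 1 + e) ^ snd k)
        * (v ^ (3 - fst k) * (v ^ p) ^ (p - snd k)))"
      by (rule expand[OF that]; simp add: fr e)+
    show ?thesis
      unfolding Y_def ex y_def A_def
      by (simp only: sum_subtractf[symmetric] sum.distrib[symmetric]) (simp only: algebra_simps)
  qed
  have Yp: "Y v ^ p = (\<Sum>k\<in>J. y k ^ p * ((v ^ p) ^ (3 - fst k) * (- v) ^ (p - snd k)))" if v: "v \<in> ?L" for v
  proof -
    have "Y v ^ p = (\<Sum>k\<in>J. (y k * (v ^ (3 - fst k) * (v ^ p) ^ (p - snd k))) ^ p)"
      unfolding Y[OF v] by (rule freshmans_dream_sum) (simp_all add: CHAR_eq prime_p)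
    also have "\<dots> = (\<Sum>k\<in>J. y k ^ p * ((v ^ p) ^ (3 - fst k) * (v ^ (p\<^sup>2)) ^ (p - snd k)))"
      unfolding pp(1)[symmetric]
      by (intro sum.cong refl) (simp only: power_mult_distrib power_mult[symmetric] mult_ac)
    finally show ?thesis unfolding Lz[OF v] .
  qed
  define E where "E d = corr ?L (\<lambda>z. Y z ^ p) Y d" for d
  have EE: "2 * E 0 - E (0 + 2 * c) - E (0 - 2 * c) = 0" if c: "c \<in> ?L" "c \<noteq> 0" for c
  proof -
    let ?G = "cdiff (\<lambda>x::'a. x ^ n) 1 e c"
    have "inj_on ?G ?L"
      by (rule inj_onI, rule PN3_D[OF PN, of 1 e c]) (use e c in simp_all)
    moreover have "?G ` ?L \<subseteq> ?S"
    proof (intro image_subsetI)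
      fix z assume z: "z \<in> ?L"
      \<comment> \<open>The (p ^ 2)-th power negates z and c. As n is even, an overall sign may be
        added, which restores z and c and negates 1 and e instead; the eight terms are permuted with
        their signs, so the difference lies in \<open>?S\<close>.\<close>
      have pw: "(x ^ n) ^ (p\<^sup>2) = (- (x ^ (p\<^sup>2))) ^ n" for x :: 'a
        unfolding evn by (simp only: power_mult[symmetric] mult.commute)
      have "?G z ^ (p\<^sup>2) = ?G z"
        unfolding cdiff_def fr pw eQ Lz[OF z] Lz[OF c(1)] by (simp add: algebra_simps)
      then show "?G z \<in> ?S" by (simp add: frob_line_def)
    qed
    ultimately have "(\<Sum>z\<in>?L. ?G z ^ (1 + p)) = (\<Sum>y\<in>?S. y ^ (1 + p))"
      by (intro sum_inj_into_same_card[of ?S ?G ?L "\<lambda>y. y ^ (1 + p)"])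
        (simp_all add: card_L0 card_L1)
    also have "\<dots> = 0"
    proof -
      have "5 * p \<le> p\<^sup>2" using p_ge by (simp add: power2_eq_square)
      have "\<not> (p\<^sup>2 - 1) dvd (1 + p)"
      proof
        assume "(p\<^sup>2 - 1) dvd (1 + p)"
        then have "p\<^sup>2 - 1 \<le> 1 + p" by (rule dvd_imp_le) simp
        with \<open>5 * p \<le> p\<^sup>2\<close> p_ge show False by linarith
      qed
      then show ?thesis unfolding sum_L0[OF disjI2[OF refl]] by simp
    qed
    finally have "(\<Sum>z\<in>?L. ?G z ^ (1 + p)) = 0" .
    moreover have G: "?G z = Y (z + c) - Y (z - c)" for z
      by (simp add: cdiff_def Y_def algebra_simps)
    have "(\<Sum>z\<in>?L. ?G z ^ (1 + p)) =
        corr ?L (\<lambda>z. Y (z + c) ^ p - Y (z - c) ^ p) (\<lambda>z. Y (z + c) - Y (z - c)) 0"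
      unfolding corr_def by (simp add: G fr mult.commute)
    moreover have "\<dots> = 2 * E 0 - E (0 + 2 * c) - E (0 - 2 * c)"
      unfolding E_def by (rule corr_central_difference[OF L1 L2 c(1), of "\<lambda>z. Y z ^ p" Y 0])
    ultimately show ?thesis by simp
  qed
  define M where "M = p\<^sup>2 - 1 - (2 + 2 * p)"
  have pge: "5 * p \<le> p\<^sup>2" using p_ge by (simp add: power2_eq_square)
  have M: "M + 2 + 2 * p = p\<^sup>2 - 1" "M > 0" "M < p\<^sup>2 - 1"
    using pge p_ge unfolding M_def by linarith+
  have "even (M + 2 + 2 * p)" unfolding M(1) using odd_p by simp
  then have evM: "even M" by simp
  \<comment> \<open>The \<open>E 0\<close> term drops out because d ^ M sums to zero, and evenness
    of M identifies the contributions of d and - d, leaving 2 * T = 0.\<close>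
  have sum0: "(\<Sum>d\<in>?L. d ^ M * E d) = 0"
  proof -
    define T where "T = (\<Sum>d\<in>?L. d ^ M * E d)"
    have s1: "(\<Sum>d\<in>?L. d ^ M * (2 * E 0 - E d - E (- d))) = 0"
    proof (intro sum.neutral ballI)
      fix d assume d: "d \<in> ?L"
      show "d ^ M * (2 * E 0 - E d - E (- d)) = 0"
      proof (cases "d = 0")
        case False
        have "d / 2 \<in> ?L" using d by (simp add: frob_line_def power_divide)
        then show ?thesis using EE[of "d / 2"] False by simp
      qed (use M in simp)
    qed
    have s2: "(\<Sum>d\<in>?L. d ^ M * (2 * E 0 - E d - E (- d))) =
      2 * E 0 * (\<Sum>d\<in>?L. d ^ M) - T - (\<Sum>d\<in>?L. d ^ M * E (- d))"
      unfolding T_def sum_distrib_left sum_subtractf[symmetric]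
      by (intro sum.cong refl) (simp only: algebra_simps)
    have s3: "(\<Sum>d\<in>?L. d ^ M * E (- d)) = T"
      unfolding T_def by (rule sum.reindex_bij_witness[of _ uminus uminus]) (use L2 evM in auto)
    have s4: "(\<Sum>d\<in>?L. d ^ M) = 0"
    proof -
      have "\<not> (p\<^sup>2 - 1) dvd M" using M(2,3) by (auto dest: dvd_imp_le)
      then show ?thesis unfolding sum_L1[OF disjI2[OF refl]] by simp
    qed
    have "- T - T = 0" using s1 unfolding s2 s3 s4 by simp
    moreover have "2 * T = - (- T - T)" by simp
    ultimately have "2 * T = 0" by (simp only: neg_0_equal_iff_equal minus_zero)
    then show ?thesis by (simp add: T_def)
  qed
  define B where "B k = (of_nat ((3 - fst k) choose 2) * of_nat ((p - snd k) choose 2) :: 'a)" for k :: "nat \<times> nat"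
  have inner: "(\<Sum>d\<in>?L. d ^ M * Y (z + d)) =
    (\<Sum>k\<in>J. y k * B k * (z ^ (3 - fst k - 2) * (z ^ p) ^ (p - snd k - 2)))" if z: "z \<in> ?L" for z
  proof -
    have "(\<Sum>d\<in>?L. d ^ M * Y (z + d)) =
      (\<Sum>d\<in>?L. \<Sum>k\<in>J. y k * (d ^ M * ((z + d) ^ (3 - fst k) * (z ^ p + d ^ p) ^ (p - snd k))))"
    proof (intro sum.cong refl)
      fix d assume d: "d \<in> ?L"
      show "d ^ M * Y (z + d) = (\<Sum>k\<in>J. y k * (d ^ M * ((z + d) ^ (3 - fst k) * (z ^ p + d ^ p) ^ (p - snd k))))"
        unfolding Y[OF L1[OF z d]] sum_distrib_left fr(1) by (intro sum.cong refl) (simp only: mult_ac)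
    qed
    also have "\<dots> = (\<Sum>k\<in>J. y k * (\<Sum>d\<in>?L. d ^ M * ((z + d) ^ (3 - fst k) * (z ^ p + d ^ p) ^ (p - snd k))))"
      unfolding sum_distrib_left by (rule sum.swap)
    also have "\<dots> = (\<Sum>k\<in>J. y k * B k * (z ^ (3 - fst k - 2) * (z ^ p) ^ (p - snd k - 2)))"
    proof (intro sum.cong refl)
      fix k assume "k \<in> J"
      show "y k * (\<Sum>d\<in>?L. d ^ M * ((z + d) ^ (3 - fst k) * (z ^ p + d ^ p) ^ (p - snd k))) =
         y k * B k * (z ^ (3 - fst k - 2) * (z ^ p) ^ (p - snd k - 2))"
        by (subst sum_twisted_extract[OF M(1)]) (simp_all add: B_def mult_ac)
    qed
    finally show ?thesis .
  qed
  define ex where "ex k l = ((3 - fst k - 2) + (p - snd l)) + p * ((p - snd k - 2) + (3 - fst l))" for k l :: "nat \<times> nat"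
  define W where "W k l = y l ^ p * (y k * B k) * (- 1) ^ (p - snd l)" for k l
  have "(\<Sum>d\<in>?L. d ^ M * E d) = (\<Sum>z\<in>?L. \<Sum>d\<in>?L. d ^ M * (Y z ^ p * Y (z + d)))"
    unfolding E_def corr_def sum_distrib_left by (rule sum.swap)
  also have "\<dots> = (\<Sum>z\<in>?L. Y z ^ p * (\<Sum>d\<in>?L. d ^ M * Y (z + d)))"
    unfolding sum_distrib_left by (intro sum.cong refl) (simp only: mult_ac)
  also have "\<dots> = (\<Sum>z\<in>?L. \<Sum>l\<in>J. \<Sum>k\<in>J. W k l * z ^ ex k l)"
  proof (intro sum.cong refl)
    fix z assume z: "z \<in> ?L"
    show "Y z ^ p * (\<Sum>d\<in>?L. d ^ M * Y (z + d)) = (\<Sum>l\<in>J. \<Sum>k\<in>J. W k l * z ^ ex k l)"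
      unfolding inner[OF z] Yp[OF z] sum_product
    proof (intro sum.cong refl)
      fix k l :: "nat \<times> nat"
      have "(- z) ^ (p - snd l) = (- 1) ^ (p - snd l) * z ^ (p - snd l)" by (rule power_minus)
      then show "y l ^ p * ((z ^ p) ^ (3 - fst l) * (- z) ^ (p - snd l)) *
         (y k * B k * (z ^ (3 - fst k - 2) * (z ^ p) ^ (p - snd k - 2))) = W k l * z ^ ex k l"
        unfolding W_def ex_def power_add power_mult distrib_left by (simp only: mult_ac)
    qed
  qed
  also have "\<dots> = (\<Sum>l\<in>J. \<Sum>k\<in>J. \<Sum>z\<in>?L. W k l * z ^ ex k l)"
    by (subst sum.swap) (intro sum.cong refl sum.swap)
  also have "\<dots> = (\<Sum>q\<in>J \<times> J. W (snd q) (fst q) * (\<Sum>z\<in>?L. z ^ ex (snd q) (fst q)))"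
    unfolding sum_distrib_left[symmetric] sum.cartesian_product by (simp add: case_prod_beta)
  also have "\<dots> = (\<Sum>q\<in>{((0, 2), (0, 2))}. W (snd q) (fst q) * (\<Sum>z\<in>?L. z ^ ex (snd q) (fst q)))"
  proof (rule sum.mono_neutral_right)
    show "finite (J \<times> J)" by (simp add: J_def)
    show "{((0, 2), (0, 2))} \<subseteq> J \<times> J" using p_ge by (simp add: J_def)
    \<comment> \<open>A nonzero factor \<open>B\<close> forces r at most 1 and 0 < s < p - 1. An
      exponent divisible by p ^ 2 - 1 must equal it, which gives r + s' = 2 and s + r' = 2. Since
      \<open>A\<close> vanishes for r + s odd and for r = s = 1, only (0, 2) remains for both
      indices.\<close>
    show "\<forall>q\<in>J \<times> J - {((0, 2), (0, 2))}. W (snd q) (fst q) * (\<Sum>z\<in>?L. z ^ ex (snd q) (fst q)) = 0"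
    proof (intro ballI, rule ccontr)
      fix q assume q: "q \<in> J \<times> J - {((0, 2), (0, 2))}"
        and nz: "W (snd q) (fst q) * (\<Sum>z\<in>?L. z ^ ex (snd q) (fst q)) \<noteq> 0"
      obtain r' s' r s where rs: "q = ((r', s'), (r, s))" by (metis surj_pair)
      have le: "r \<le> 3" "s \<le> p" "r' \<le> 3" "s' \<le> p" using q by (auto simp: rs J_def)
      have "y (r', s') \<noteq> 0" "y (r, s) \<noteq> 0" "B (r, s) \<noteq> 0"
        using nz p_ge by (auto simp: rs W_def)
      then have A_nz: "A r' s' \<noteq> 0" "A r s \<noteq> 0"
        and "(of_nat ((3 - r) choose 2) :: 'a) \<noteq> 0" and Bs: "(of_nat ((p - s) choose 2) :: 'a) \<noteq> 0"
        by (auto simp: y_def B_def)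
      then have "(3 - r) choose 2 \<noteq> 0" "(p - s) choose 2 \<noteq> 0"
        by (metis of_nat_0)+
      then have r: "r \<le> 1" and s: "s + 2 \<le> p" by (simp_all add: binomial_eq_0_iff)
      have "s \<noteq> 0"
      proof
        assume "s = 0"
        moreover have "p dvd (p choose 2)" using prime_p p_ge by (intro dvd_choose_prime) auto
        ultimately show False using Bs by (simp add: of_nat_eq_0)
      qed
      have "0 < ex (r, s) (r', s')" "(p\<^sup>2 - 1) dvd ex (r, s) (r', s')"
        using nz unfolding sum_L1[OF disjI2[OF refl]] by (auto simp: rs split: if_splits)
      moreover define e0 where "e0 = (3 - r - 2) + (p - s')"
      moreover define e1 where "e1 = (p - s - 2) + (3 - r')"
      ultimately have e01: "0 < e0 + p * e1" "(p\<^sup>2 - 1) dvd (e0 + p * e1)" by (simp_all add: ex_def)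
      have b: "e0 \<le> p + 1" "e1 \<le> p" using \<open>s \<noteq> 0\<close> s by (simp_all add: e0_def e1_def)
      from e01 obtain k where k: "e0 + p * e1 = (p\<^sup>2 - 1) * k" by (elim dvdE)
      have "k = 1"
      proof (rule ccontr)
        assume "k \<noteq> 1"
        moreover have "k \<noteq> 0" using k e01 by (intro notI) simp
        ultimately have "(p\<^sup>2 - 1) * 2 \<le> (p\<^sup>2 - 1) * k" by (intro mult_left_mono) auto
        moreover have "p * e1 \<le> p\<^sup>2" using b by (simp add: power2_eq_square)
        ultimately have "(p\<^sup>2 - 1) * 2 \<le> p + 1 + p\<^sup>2" using k b(1) by linarith
        then show False using pge p_ge by linarith
      qed
      then have k1: "e0 + 1 + p * e1 = p * p" using k M(2,3) by (simp add: power2_eq_square)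
      then have "p dvd e0 + 1" by (metis dvd_add_left_iff dvd_triv_left)
      then obtain t where t: "e0 + 1 = p * t" by (elim dvdE)
      have "t = 1"
      proof (rule ccontr)
        assume "t \<noteq> 1"
        moreover have "t \<noteq> 0" using t by (intro notI) simp
        ultimately have "p * 2 \<le> p * t" by (intro mult_left_mono) auto
        with t b p_ge show False by simp
      qed
      with t have e0: "e0 + 1 = p" by simp
      with k1 have "p * (e1 + 1) = p * p" by simp
      then have e1: "e1 + 1 = p" using p_ge by (simp only: mult_cancel1) simp
      have "r + s' = 2" using e0 r le by (simp add: e0_def)
      moreover have "s + r' = 2" using e1 s le \<open>s \<noteq> 0\<close> by (simp add: e1_def)
      moreover have "even (r + s)" using A_nz(2) A_odd by blast
      moreover have "\<not> (r = 1 \<and> s = 1)" using A_nz(2) A11 by blast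
      ultimately have "r = 0 \<and> s = 2 \<and> r' = 0 \<and> s' = 2" using r \<open>s \<noteq> 0\<close>
        by (cases "r = 0") (auto elim!: oddE evenE simp: le_Suc_eq)
      then show False using q by (simp add: rs)
    qed
  qed
  also have "\<dots> = - (y (0, 2) ^ p * (y (0, 2) * B (0, 2)))"
  proof -
    define p' where "p' = p - 4"
    have p': "p = p' + 4" using p_ge by (simp add: p'_def)
    have "ex (0, 2) (0, 2) = p\<^sup>2 - 1" by (simp add: ex_def p' power2_eq_square algebra_simps)
    \<comment> \<open>The line sum for exponent p ^ 2 - 1 is 1, so the minus sign of the result
      comes from here.\<close>
    moreover have "(- 1 :: 'a) ^ (p - 2) = - 1" using odd_p p_ge by simp
    ultimately show ?thesis
      using M(2,3) unfolding sum_L1[OF disjI2[OF refl]] by (simp add: W_def)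
  qed
  finally have "y (0, 2) ^ p * (y (0, 2) * B (0, 2)) = 0" using sum0 by simp
  moreover have "B (0, 2) \<noteq> 0"
    
    using not_dvd_binomial[of "p - 2" 2] not_dvd_binomial[of 3 2] p_ge by (simp add: B_def of_nat_eq_0)
  moreover have "y (0, 2) \<noteq> 0"
  proof -
    \<comment> \<open>As n1 + n3 = p vanishes in the field, the formula for the coefficient of
      degree 2 collapses to a sign times (2 * n1) ^ 2.\<close>
    have s0: "(of_nat n1 :: 'a) + of_nat n3 = 0" using dig(2) of_nat_eq_0[of p] by (metis of_nat_add dvd_refl)
    then have n3: "(of_nat n3 :: 'a) = - of_nat n1" by (simp only: add_eq_0_iff)
    have "2 * \<kappa> 2 = (- 1) ^ n3 * (2 * of_nat n1)\<^sup>2"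
      unfolding \<kappa>_def coeff_split_poly of_nat_add s0 unfolding n3
      by (simp only: diff_minus_eq_add mult_2 diff_0_right)
    moreover have "(of_nat n1 :: 'a) \<noteq> 0"
      using dig unfolding of_nat_eq_0 by (auto dest: dvd_imp_le)
    ultimately have "2 * \<kappa> 2 \<noteq> 0" by simp
    then have "\<kappa> 2 \<noteq> 0" by simp
    moreover have "h 0 \<noteq> 0" by (simp add: h_def coeff_split_poly)
    moreover have "A 0 2 = - (2 * 4 * e)" by (simp add: A_def power2_eq_square algebra_simps)
    moreover have "2 * 4 * e \<noteq> 0" using e by (simp only: mult_eq_0_iff numeral_neq_0 simp_thms)
    ultimately show ?thesis by (simp add: y_def)
  qed
  ultimately show False by simp
qed

end

section \<open>Exponents over the prime field\<close>

context quartic_field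
begin

section \<open>Power sums of planar functions on the prime field\<close>

abbreviation Fp :: "'a set" where "Fp \<equiv> frob_line p 1"

lemma Fp_closed:
  "0 \<in> Fp" "1 \<in> Fp" "x \<in> Fp \<Longrightarrow> y \<in> Fp \<Longrightarrow> x + y \<in> Fp" "x \<in> Fp \<Longrightarrow> y \<in> Fp \<Longrightarrow> x - y \<in> Fp"
  "x \<in> Fp \<Longrightarrow> y \<in> Fp \<Longrightarrow> x * y \<in> Fp" "x \<in> Fp \<Longrightarrow> - x \<in> Fp"
  "x \<in> Fp \<Longrightarrow> x ^ k \<in> Fp"
proof -
  have "(x ^ k) ^ p = (x ^ p) ^ k" by (simp only: power_mult[symmetric] mult.commute)
  then show "x \<in> Fp \<Longrightarrow> x ^ k \<in> Fp" by (simp add: frob_line_def)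
qed (use p_ge frob_add[of x y 1] frob_diff[of x y 1] frob_uminus[of x 1] in
    \<open>auto simp: frob_line_def power_mult_distrib\<close>)

lemma sum_Fp: "(\<Sum>x\<in>Fp. x ^ k) = (if k > 0 \<and> (p - 1) dvd k then - 1 else (0::'a))"
  by (rule sum_L0) simp

text \<open>
  Planarity of \<open>\<phi>\<close> over the prime field makes the sum of \<open>(\<phi> x - \<phi> y) ^ (2 * i)\<close> over all pairs vanish;
  once the smaller power sums are known to be zero, it reduces to the square of the \<open>i\<close>-th one.
\<close>

lemma power_sums_vanish:
  fixes \<phi> :: "'a \<Rightarrow> 'a"
  assumes \<phi>: "\<And>x. x \<in> Fp \<Longrightarrow> \<phi> x \<in> Fp"
    and inj: "\<And>c. c \<in> Fp \<Longrightarrow> c \<noteq> 0 \<Longrightarrow> inj_on (\<lambda>x. \<phi> (x + c) - \<phi> x) Fp"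
  shows "2 * i < p - 1 \<Longrightarrow> (\<Sum>x\<in>Fp. \<phi> x ^ i) = 0"
proof (induction i rule: less_induct)
  case (less i)
  show ?case
  proof (cases "i = 0")
    case True
    then show ?thesis using sum_Fp[of 0] by simp
  next
    case False
    define s where "s j = (\<Sum>x\<in>Fp. \<phi> x ^ j)" for j
    have "(\<Sum>c\<in>Fp. \<Sum>x\<in>Fp. (\<phi> (x + c) - \<phi> x) ^ (2 * i)) = 0"
    proof (rule sum.neutral, rule ballI)
      fix c assume c: "c \<in> Fp"
      show "(\<Sum>x\<in>Fp. (\<phi> (x + c) - \<phi> x) ^ (2 * i)) = 0"
      proof (cases "c = 0")
        case True
        then show ?thesis using False by (simp add: power_0_left)
      next
        case c0: False
        have "(\<lambda>x. \<phi> (x + c) - \<phi> x) ` Fp \<subseteq> Fp"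
          using c by (intro image_subsetI Fp_closed \<phi>)
        then have "(\<Sum>x\<in>Fp. (\<phi> (x + c) - \<phi> x) ^ (2 * i)) = (\<Sum>y\<in>Fp. y ^ (2 * i))"
          using inj[OF c c0]
          by (intro sum_inj_into_same_card[of Fp "\<lambda>x. \<phi> (x + c) - \<phi> x" Fp "\<lambda>y. y ^ (2 * i)"]) auto
        moreover have "\<not> (p - 1) dvd (2 * i)" using less.prems False by (auto dest: dvd_imp_le)
        ultimately show ?thesis unfolding sum_Fp by simp
      qed
    qed
    moreover have "(\<Sum>c\<in>Fp. \<Sum>x\<in>Fp. (\<phi> (x + c) - \<phi> x) ^ (2 * i)) =
      (\<Sum>j\<le>2 * i. of_nat (2 * i choose j) * (- 1) ^ (2 * i - j) * (s (2 * i - j) * s j))"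
    proof -
      have "(\<Sum>c\<in>Fp. \<Sum>x\<in>Fp. (\<phi> (x + c) - \<phi> x) ^ (2 * i)) =
        (\<Sum>x\<in>Fp. \<Sum>c\<in>Fp. (\<phi> (x + c) - \<phi> x) ^ (2 * i))" by (rule sum.swap)
      also have "\<dots> = (\<Sum>x\<in>Fp. \<Sum>y\<in>Fp. (\<phi> y + - \<phi> x) ^ (2 * i))"
      proof (rule sum.cong[OF refl])
        fix x assume x: "x \<in> Fp"
        show "(\<Sum>c\<in>Fp. (\<phi> (x + c) - \<phi> x) ^ (2 * i)) = (\<Sum>y\<in>Fp. (\<phi> y + - \<phi> x) ^ (2 * i))"
          by (rule sum.reindex_bij_witness[of _ "\<lambda>y. y - x" "\<lambda>c. x + c"]) (auto intro: Fp_closed x)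
      qed
      also have "\<dots> = (\<Sum>x\<in>Fp. \<Sum>y\<in>Fp. \<Sum>j\<le>2 * i.
          of_nat (2 * i choose j) * \<phi> y ^ j * (- \<phi> x) ^ (2 * i - j))"
        unfolding binomial_ring ..
      also have "\<dots> = (\<Sum>x\<in>Fp. \<Sum>j\<le>2 * i. \<Sum>y\<in>Fp.
          of_nat (2 * i choose j) * \<phi> y ^ j * (- \<phi> x) ^ (2 * i - j))"
        by (intro sum.cong refl sum.swap)
      also have "\<dots> = (\<Sum>j\<le>2 * i. \<Sum>x\<in>Fp. \<Sum>y\<in>Fp.
          of_nat (2 * i choose j) * \<phi> y ^ j * (- \<phi> x) ^ (2 * i - j))"
        by (rule sum.swap)
      also have "\<dots> = (\<Sum>j\<le>2 * i. of_nat (2 * i choose j) * (- 1) ^ (2 * i - j) * (s (2 * i - j) * s j))"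
        unfolding s_def sum_product unfolding sum_distrib_left
        by (intro sum.cong refl) (subst power_minus, simp only: mult_ac)
      finally show ?thesis .
    qed
    moreover have "\<dots> = (\<Sum>j\<in>{i}. of_nat (2 * i choose j) * (- 1) ^ (2 * i - j) * (s (2 * i - j) * s j))"
    proof (rule sum.mono_neutral_right)
      show "\<forall>j\<in>{..2 * i} - {i}. of_nat (2 * i choose j) * (- 1) ^ (2 * i - j) * (s (2 * i - j) * s j) = 0"
      proof
        fix j assume j: "j \<in> {..2 * i} - {i}"
        then have "j < i \<or> 2 * i - j < i" by auto
        then have "s j = 0 \<or> s (2 * i - j) = 0"
          unfolding s_def using less.IH less.prems by fastforce
        then show "of_nat (2 * i choose j) * (- 1) ^ (2 * i - j) * (s (2 * i - j) * s j) = 0" by auto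
      qed
    qed auto
    ultimately have "of_nat (2 * i choose i) * (- 1) ^ i * (s i * s i) = 0" by simp
    \<comment> \<open>The bound 2 * i < p keeps the central binomial coefficient prime to p.\<close>
    moreover have "(of_nat (2 * i choose i) :: 'a) \<noteq> 0"
      using not_dvd_binomial[of "2 * i" i] less.prems by (simp add: of_nat_eq_0)
    ultimately show ?thesis by (simp add: s_def)
  qed
qed

text \<open>Adding u * x preserves planarity, so the m-th power sum of u * x + \<phi> x vanishes for
  every u in the prime field. Summing against u ^ (p - 1 - r) isolates the coefficient of u ^ r,
  whose binomial factor is prime to p.\<close>

lemma mixed_power_sums_vanish:
  fixes \<phi> :: "'a \<Rightarrow> 'a"
  assumes \<phi>: "\<And>x. x \<in> Fp \<Longrightarrow> \<phi> x \<in> Fp"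
    and inj: "\<And>c. c \<in> Fp \<Longrightarrow> c \<noteq> 0 \<Longrightarrow> inj_on (\<lambda>x. \<phi> (x + c) - \<phi> x) Fp"
    and rt: "2 * (r + t) < p - 1"
  shows "(\<Sum>x\<in>Fp. x ^ r * \<phi> x ^ t) = 0"
proof -
  define m where "m = r + t"
  have van: "(\<Sum>x\<in>Fp. (u * x + \<phi> x) ^ m) = 0" if u: "u \<in> Fp" for u
  proof (rule power_sums_vanish)
    show "u * x + \<phi> x \<in> Fp" if "x \<in> Fp" for x using that u \<phi> by (intro Fp_closed)
    show "inj_on (\<lambda>x. u * (x + c) + \<phi> (x + c) - (u * x + \<phi> x)) Fp" if "c \<in> Fp" "c \<noteq> 0" for c
      using inj[OF that] by (simp add: inj_on_def algebra_simps)
  qed (use rt in \<open>simp add: m_def\<close>)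
  define T where "T j = of_nat (m choose j) * (\<Sum>x\<in>Fp. x ^ j * \<phi> x ^ (m - j))" for j
  have "0 = (\<Sum>u\<in>Fp. u ^ (p - 1 - r) * (\<Sum>x\<in>Fp. (u * x + \<phi> x) ^ m))"
    by (simp add: van)
  also have "\<dots> = (\<Sum>u\<in>Fp. \<Sum>j\<le>m. T j * u ^ (p - 1 - r + j))"
  proof (intro sum.cong refl)
    fix u
    have inner: "(\<Sum>x\<in>Fp. (u * x + \<phi> x) ^ m) = (\<Sum>j\<le>m. \<Sum>x\<in>Fp. of_nat (m choose j) * (u * x) ^ j * \<phi> x ^ (m - j))"
      unfolding binomial_ring by (rule sum.swap)
    show "u ^ (p - 1 - r) * (\<Sum>x\<in>Fp. (u * x + \<phi> x) ^ m) = (\<Sum>j\<le>m. T j * u ^ (p - 1 - r + j))"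
      unfolding inner T_def sum_distrib_left sum_distrib_right
      by (intro sum.cong refl) (simp only: power_add power_mult_distrib mult_ac)
  qed
  also have "\<dots> = (\<Sum>j\<le>m. T j * (\<Sum>u\<in>Fp. u ^ (p - 1 - r + j)))"
    unfolding sum_distrib_left by (rule sum.swap)
  also have "\<dots> = (\<Sum>j\<le>m. if j = r then - T j else 0)"
  proof (intro sum.cong refl)
    fix j assume j: "j \<in> {..m}"
    define N e where "N = p - 1" and "e = N - r"
    have N: "e + r = N" "2 * (r + t) < N" using rt by (simp_all add: N_def e_def)
    have jm: "j \<le> r + t" using j by (simp add: m_def)
    have "N dvd (e + j) \<longleftrightarrow> j = r"
    proof
      assume "N dvd (e + j)"
      then obtain k where k: "e + j = N * k" by (elim dvdE)
      have "k < 2"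
      proof (rule ccontr)
        assume "\<not> k < 2"
        then have "N * 2 \<le> e + j" unfolding k by (intro mult_left_mono) auto
        then have "N \<le> t" using N(1) jm by linarith
        then show False using N(2) by simp
      qed
      moreover have "k \<noteq> 0" using k N by (intro notI) simp
      ultimately have "k = 1" by simp
      then show "j = r" using k N by simp
    qed (use N in simp)
    then have dv: "(p - 1) dvd (p - 1 - r + j) \<longleftrightarrow> j = r" by (simp only: N_def e_def)
    have "p - 1 - r + j > 0" using rt by simp
    then show "T j * (\<Sum>u\<in>Fp. u ^ (p - 1 - r + j)) = (if j = r then - T j else 0)"
      unfolding sum_Fp dv by simp
  qed
  also have "\<dots> = - T r" by (simp add: m_def)
  finally have "T r = 0" by simp
  moreover have "(of_nat (m choose r) :: 'a) \<noteq> 0"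
    using not_dvd_binomial[of m r] rt by (simp add: of_nat_eq_0 m_def)
  ultimately show ?thesis by (simp add: T_def m_def)
qed

text \<open>Below degree 2 * (p - 1) the only exponent with a nonzero power sum is p - 1.\<close>

lemma sum_poly_Fp:
  fixes P :: "'a poly"
  assumes "degree P < 2 * (p - 1)"
  shows "(\<Sum>x\<in>Fp. poly P x) = - coeff P (p - 1)"
proof -
  have "(\<Sum>x\<in>Fp. poly P x) = (\<Sum>i\<le>degree P. coeff P i * (\<Sum>x\<in>Fp. x ^ i))"
    unfolding poly_altdef sum_distrib_left by (rule sum.swap)
  also have "\<dots> = (\<Sum>i\<le>degree P. if i = p - 1 then - coeff P i else 0)"
  proof (intro sum.cong refl)
    fix i assume i: "i \<in> {..degree P}"
    have "i > 0 \<and> (p - 1) dvd i \<longleftrightarrow> i = p - 1"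
    proof
      assume "i > 0 \<and> (p - 1) dvd i"
      then obtain k where k: "i = (p - 1) * k" "k \<noteq> 0" by auto
      have "k < 2"
      proof (rule ccontr)
        assume "\<not> k < 2"
        then have "(p - 1) * 2 \<le> i" unfolding k(1) by (intro mult_left_mono) auto
        moreover have "i \<le> degree P" using i by simp
        ultimately show False using assms by linarith
      qed
      then have "k = 1" using k by simp
      then show "i = p - 1" using k by simp
    qed (use p_ge in simp)
    then show "coeff P i * (\<Sum>x\<in>Fp. x ^ i) = (if i = p - 1 then - coeff P i else 0)"
      unfolding sum_Fp by simp
  qed
  also have "\<dots> = - coeff P (p - 1)" by (simp add: coeff_eq_0)
  finally show ?thesis .
qed

text \<open>The exceptional case below is \<open>d = (p + 5) / 2\<close>, where \<open>r + t\<close> is too large for \<open>mixed_power_sums_vanish\<close>.\<close>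

lemma prime_field_exponent:
  assumes PN: "PN3 (\<lambda>x::'a. x ^ n)" and d: "1 \<le> d" "d \<le> p - 1"
    and nd: "\<And>x::'a. x ^ p = x \<Longrightarrow> x ^ n = x ^ d"
  shows "d = 4"
proof (rule ccontr)
  assume "d \<noteq> 4"
  have m1: "(- 1 :: 'a) ^ p = - 1" using odd_p by simp
  have "(- 1 :: 'a) ^ d = 1" using nd[OF m1] PN3_even[OF PN] by simp
  moreover have "(- 1 :: 'a) \<noteq> 1" using uminus_neq_self[of 1] by simp
  ultimately have ev: "even d" by (cases "even d") auto
  define \<phi> where "\<phi> x = (x + 1) ^ n - 2 * x ^ n + (x - 1) ^ n" for x :: 'a
  define P where "P = [:1, 1:] ^ d - monom 2 d + ([:- 1, 1:] :: 'a poly) ^ d"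
  have \<phi>P: "\<phi> x = poly P x" if "x \<in> Fp" for x
    using nd[of x] nd[of "x + 1"] nd[of "x - 1"] Fp_closed(3)[OF that Fp_closed(2)]
      Fp_closed(4)[OF that Fp_closed(2)] that
    by (simp add: \<phi>_def P_def frob_line_def poly_monom add.commute)
  have \<phi>: "\<phi> x \<in> Fp" if "x \<in> Fp" for x
    unfolding \<phi>_def mult_2 using that by (intro Fp_closed)
  have inj: "inj_on (\<lambda>x. \<phi> (x + c) - \<phi> x) Fp" if "c \<in> Fp" "c \<noteq> 0" for c
  proof (rule inj_onI)
    fix x y assume eq: "\<phi> (x + c) - \<phi> x = \<phi> (y + c) - \<phi> y"
    \<comment> \<open>The steps of \<open>cdiff\<close> are twice its directions; halving them and
      shifting by \<open>u\<close> turns the third difference with steps 1, 1, c into a first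
      difference of \<phi>.\<close>
    define h :: 'a where "h = 1 / 2"
    define u where "u = c / 2"
    have hu: "h + h = 1" "u + u = c" "h \<noteq> 0" "u \<noteq> 0"
      using that by (simp_all add: h_def u_def field_simps)
    have pts: "z + u + h + h + u = z + c + 1" "z + u + h + h - u = z + 1"
       "z + u + h - h + u = z + c" "z + u + h - h - u = z"
       "z + u - h + h + u = z + c" "z + u - h + h - u = z"
       "z + u - h - h + u = z + c - 1" "z + u - h - h - u = z - 1" for z
      by (simp_all add: hu(1,2)[symmetric] algebra_simps)
    have "cdiff (\<lambda>x. x ^ n) h h u (z + u) = \<phi> (z + c) - \<phi> z" for z
      unfolding cdiff_def pts \<phi>_def by (simp add: algebra_simps)
    then have "cdiff (\<lambda>x. x ^ n) h h u (x + u) = cdiff (\<lambda>x. x ^ n) h h u (y + u)"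
      using eq by simp
    then have "x + u = y + u" by (rule PN3_D[OF PN hu(3,3,4)])
    then show "x = y" by simp
  qed
  have cP: "coeff P j = of_nat (d choose j) * (1 + (- 1) ^ (d - j)) - (if j = d then 2 else 0)" if "j \<le> d" for j
    using that by (simp add: P_def coeff_linear_poly_power algebra_simps)
  \<comment> \<open>For even d the coefficients of degree d and d - 1 both cancel in the second
    difference.\<close>
  have degP: "degree P \<le> d - 2"
  proof (rule degree_le, intro allI impI)
    fix i assume i: "d - 2 < i"
    consider "i = d" | "i = d - 1" "d \<ge> 2" | "i > d" 
      using i d ev by (cases "d < 2") (auto elim!: evenE, linarith)
    then show "coeff P i = 0"
    proof cases
      case 3
      then have "coeff ([:c, 1:] ^ d) i = (0 :: 'a)" for c
        by (intro coeff_eq_0) (simp add: degree_linear_power)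
      then show ?thesis using 3 by (simp add: P_def)
    qed (use ev cP[of i] in auto)
  qed
  have not2: "d \<noteq> 2"
  proof
    assume "d = 2"
    then have "degree P = 0" using degP by simp
    then have "poly P x = coeff P 0" for x by (metis degree_0_id poly_const_conv coeff_pCons_0 degree_eq_zeroE)
    then have "\<phi> (x + 1) - \<phi> x = 0" if "x \<in> Fp" for x
      using \<phi>P that Fp_closed(3)[OF that Fp_closed(2)] by simp
    then have "\<phi> (0 + 1) - \<phi> 0 = \<phi> (1 + 1) - \<phi> 1" using Fp_closed(1,2) by (simp only:)
    then have "(0 :: 'a) = 1"
      by (rule inj_onD[OF inj[OF Fp_closed(2) one_neq_zero] _ Fp_closed(1,2)])
    then show False by simp
  qed
  have d6: "6 \<le> d" using ev not2 \<open>d \<noteq> 4\<close> d by (auto elim!: evenE)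
  define D where "D = d - 2"
  have D: "4 \<le> D" "D + 2 \<le> p - 1" "even D" "d = D + 2" using d6 d ev by (auto simp: D_def)
  have cD: "coeff P D = 2 * of_nat (d choose 2)" "coeff P (D - 1) = 0" "coeff P (D - 2) = 2 * of_nat (d choose 4)"
  proof -
    define q where "q = D - 2"
    have q: "D = q + 2" "d = q + 4" using D by (simp_all add: q_def)
    have ch: "d choose (q + 2) = d choose 2" "d choose q = d choose 4"
      using binomial_symmetric[of 2 d] binomial_symmetric[of 4 d] q(2) by simp_all
    have "coeff P (q + 2) = of_nat (d choose (q + 2)) * (1 + (- 1) ^ 2)"
      "coeff P (q + 1) = of_nat (d choose (q + 1)) * (1 + (- 1) ^ 3)"
      "coeff P q = of_nat (d choose q) * (1 + (- 1) ^ 4)"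
      using cP[of "q + 2"] cP[of "q + 1"] cP[of q] q(2) by simp_all
    then show "coeff P D = 2 * of_nat (d choose 2)" "coeff P (D - 1) = 0" "coeff P (D - 2) = 2 * of_nat (d choose 4)"
      unfolding ch q(1) by simp_all
  qed
  have b: "(of_nat (d choose 2) :: 'a) \<noteq> 0" "(of_nat (d choose 4) :: 'a) \<noteq> 0"
    using not_dvd_binomial[of d] d6 d p_ge by (simp_all add: of_nat_eq_0)
  \<comment> \<open>Division with remainder gives x ^ r * P ^ t degree exactly p - 1, so its sum
    over the prime field is minus a power of the nonzero leading coefficient of P. For small r + t
    this sum must vanish.\<close>
  define t where "t = (p - 1) div D"
  define r where "r = (p - 1) mod D"
  have tr: "D * t + r = p - 1" by (simp add: t_def r_def)
  show False
  proof (cases "2 * (r + t) < p - 1")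
    case True
    let ?R = "monom 1 r * P ^ t"
    have "(\<Sum>x\<in>Fp. poly ?R x) = (\<Sum>x\<in>Fp. x ^ r * \<phi> x ^ t)"
      by (intro sum.cong refl) (simp add: \<phi>P poly_monom)
    also have "\<dots> = 0" by (rule mixed_power_sums_vanish[OF \<phi> inj True])
    finally have "coeff ?R (p - 1) = 0"
    proof -
      have "degree ?R \<le> degree (monom (1::'a) r) + degree (P ^ t)" by (rule degree_mult_le)
      also have "\<dots> \<le> r + D * t"
        by (intro add_mono degree_monom_le order_trans[OF degree_power_le] mult_right_mono)
          (use degP in \<open>simp_all add: D_def\<close>)
      finally show "(\<Sum>x\<in>Fp. poly ?R x) = 0 \<Longrightarrow> coeff ?R (p - 1) = 0"
        using sum_poly_Fp[of ?R] tr p_ge by simp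
    qed
    moreover have "coeff ?R (p - 1) = coeff P D ^ t"
    proof -
      have "degree P = D" using degP cD(1) b(1) le_degree[of P D] by (simp add: D_def)
      moreover have "P \<noteq> 0" using cD(1) b(1) by auto
      ultimately have "coeff (P ^ t) (t * D) = coeff P D ^ t"
        using lead_coeff_power[of P t] by (simp add: degree_power_eq)
      moreover have "p - 1 - r = t * D" using tr by (simp add: mult.commute)
      ultimately show ?thesis using tr by (simp add: coeff_monom_mult)
    qed
    ultimately show False using cD b by simp
  next
    case False
    \<comment> \<open>Failure of the bound means that (D - 2) * t is at most r, while r is even and
      below D; this forces t = 1 and r = D - 2. Then P ^ 2 is used instead: its coefficient of
      degree 2 * D - 2 is a pure cross term, as P has no term of degree D - 1.\<close>
    have ex: "p - 1 = 2 * D - 2"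
    proof -
      have "even (D * t + r)" unfolding tr using odd_p by simp
      then have "even r" using D(3) by simp
      moreover have "r < D" using D by (simp add: r_def)
      ultimately have r: "r \<le> D - 2" using D(3) by (auto elim!: evenE)
      define D' where "D' = D - 2"
      have D': "D = D' + 2" "D' \<ge> 2" using D by (simp_all add: D'_def)
      have le: "D' * t \<le> r" using False unfolding tr[symmetric] D'(1) by (simp add: algebra_simps)
      have "t \<noteq> 0" using tr D \<open>r < D\<close> by (intro notI) simp
      moreover have "t < 2"
      proof (rule ccontr)
        assume "\<not> t < 2"
        then have "D' * 2 \<le> D' * t" by (intro mult_left_mono) auto
        with le r D' show False by simp
      qed
      ultimately have "t = 1" by simp
      with le r D' have "r = D'" by simp
      with tr \<open>t = 1\<close> D' show ?thesis by simp
    qed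
    have "(\<Sum>x\<in>Fp. poly (P\<^sup>2) x) = (\<Sum>x\<in>Fp. x ^ 0 * \<phi> x ^ 2)"
      by (intro sum.cong refl) (simp add: \<phi>P)
    also have "\<dots> = 0" by (rule mixed_power_sums_vanish[OF \<phi> inj]) (use ex D in auto)
    finally have "coeff (P\<^sup>2) (p - 1) = 0"
    proof -
      have "degree (P\<^sup>2) \<le> D * 2" using degree_power_le[of P 2] degP by (simp add: D_def)
      then show "(\<Sum>x\<in>Fp. poly (P\<^sup>2) x) = 0 \<Longrightarrow> coeff (P\<^sup>2) (p - 1) = 0"
        using sum_poly_Fp[of "P\<^sup>2"] ex D by simp
    qed
    moreover have "coeff (P\<^sup>2) (p - 1) = 2 * coeff P D * coeff P (D - 2)"
    proof -
      have "coeff (P\<^sup>2) (p - 1) = (\<Sum>i\<le>2 * D - 2. coeff P i * coeff P (2 * D - 2 - i))"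
        unfolding power2_eq_square coeff_mult ex ..
      also have "\<dots> = (\<Sum>i\<in>{D - 2, D - 1, D}. coeff P i * coeff P (2 * D - 2 - i))"
      proof (rule sum.mono_neutral_right)
        show "\<forall>i\<in>{..2 * D - 2} - {D - 2, D - 1, D}. coeff P i * coeff P (2 * D - 2 - i) = 0"
        proof
          fix i assume "i \<in> {..2 * D - 2} - {D - 2, D - 1, D}"
          then have "i > degree P \<or> 2 * D - 2 - i > degree P" using degP D by auto
          then show "coeff P i * coeff P (2 * D - 2 - i) = 0" by (auto simp: coeff_eq_0)
        qed
      qed (use D in auto)
      also have "\<dots> = 2 * coeff P D * coeff P (D - 2)"
      proof -
        define q where "q = D - 2"
        have "D = q + 2" using D by (simp add: q_def)
        then show ?thesis using cD(2) by (simp add: mult_ac)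
      qed
      finally show ?thesis .
    qed
    ultimately have "2 * coeff P D * coeff P (D - 2) = 0" by (simp only:)
    then show False using b by (simp only: cD(1,3) mult_eq_0_iff numeral_neq_0 simp_thms)
  qed
qed

end

section \<open>Determination of the exponent\<close>

text \<open>Requiring i to be positive covers x = 0; exponents are therefore reduced to the range
  from 1 to Q - 1 rather than from 0.\<close>

lemma power_reduce_exponent:
  fixes x :: "'a::monoid_mult"
  assumes "x ^ Q = x" "Q \<ge> 1" "i \<ge> 1"
  shows "x ^ (i + (Q - 1) * k) = x ^ i"
proof (induction k)
  case (Suc k)
  have e: "i + (Q - 1) * Suc k = (i + (Q - 1) * k - 1) + Q" using assms by (cases i) auto
  have "x ^ (i + (Q - 1) * Suc k) = x ^ (i + (Q - 1) * k - 1) * x ^ 1"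
    unfolding e power_add by (simp add: assms)
  also have "\<dots> = x ^ (i + (Q - 1) * k)" unfolding power_add[symmetric] using assms by simp
  finally show ?case using Suc by simp
qed simp

context quartic_field
begin

text \<open>The sums s0 = n0 + n2 and s1 = n1 + n3 satisfy s0 + p * s1 = 4 or p ^ 2 + 3, so (s0, s1)
  is (4, 0), (3, p) or (p + 3, p - 1), treated by \<open>weight_four\<close>,
  \<open>mixed_type\<close> and \<open>norm_type\<close> respectively. The digits enter through
  \<open>f\<close> alone, so the rotated digits of p * n can be used as well.\<close>

lemma digits_of_PN3:
  assumes PN: "PN3 (\<lambda>x::'a. x ^ n)"
    and f: "\<And>x::'a. x ^ n = x ^ n0 * (x ^ p) ^ n1 * (x ^ (p\<^sup>2)) ^ n2 * ((x ^ p) ^ (p\<^sup>2)) ^ n3"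
    and lt: "n0 < p" "n1 < p" "n2 < p" "n3 < p"
    and cong: "(n0 + n2 + p * (n1 + n3)) mod (p\<^sup>2 - 1) = 4"
  shows "n1 = 0 \<and> n3 = 0 \<and> (n0 = 4 \<and> n2 = 0 \<or> n0 = 0 \<and> n2 = 4)"
proof -
  define W where "W = p\<^sup>2 - 1"
  have pge: "5 * p \<le> p\<^sup>2" using p_ge by (simp add: power2_eq_square)
  have W: "W + 1 = p\<^sup>2" using pge p_ge unfolding W_def by linarith
  define s0 s1 where "s0 = n0 + n2" and "s1 = n1 + n3"
  define k where "k = (s0 + p * s1) div W"
  have k: "s0 + p * s1 = 4 + W * k"
    using cong div_mult_mod_eq[of "s0 + p * s1" W] by (simp add: k_def s0_def s1_def W_def mult.commute)
  have s: "s0 + 2 \<le> 2 * p" "s1 + 2 \<le> 2 * p" using lt by (simp_all add: s0_def s1_def)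
  have "p * (s1 + 2) \<le> p * (2 * p)" using s by (intro mult_left_mono) auto
  then have "p * s1 + 2 * p \<le> 2 * p\<^sup>2" by (simp add: power2_eq_square algebra_simps)
  then have le: "4 + W * k < W * 2 + 1" using k s W by linarith
  have "k < 2"
  proof (rule ccontr)
    assume "\<not> k < 2"
    then have "W * 2 \<le> W * k" by (intro mult_left_mono) auto
    with le show False by linarith
  qed
  then consider "k = 0" | "k = 1" by linarith
  then show ?thesis
  proof cases
    case 1
    then have "s0 + p * s1 = 4" using k by simp
    moreover have "s1 = 0"
    proof (rule ccontr)
      assume "s1 \<noteq> 0"
      then have "p * 1 \<le> p * s1" by (intro mult_left_mono) auto
      with \<open>s0 + p * s1 = 4\<close> p_ge show False by linarith
    qed
    ultimately have z: "n1 = 0" "n3 = 0" and s4: "n0 + n2 = 4" by (simp_all add: s0_def s1_def)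
    have "n0 = 0 \<or> n2 = 0"
    proof (rule ccontr)
      assume "\<not> (n0 = 0 \<or> n2 = 0)"
      then show False
        using weight_four[of "p\<^sup>2" n n0 n2] PN f z s4 by simp
    qed
    with z s4 show ?thesis by auto
  next
    case 2
    then have e: "s0 + p * s1 = 3 + p * p" using k W by (simp add: power2_eq_square)
    have "s0 mod p = 3 mod p" using arg_cong[OF e, of "\<lambda>t. t mod p"] by simp
    then have m3: "s0 mod p = 3" using p_ge by simp
    define t where "t = s0 div p"
    have t: "s0 = p * t + 3" using mult_div_mod_eq[of p s0] m3 by (simp add: t_def)
    have "t < 2"
    proof (rule ccontr)
      assume "\<not> t < 2"
      then have "p * 2 \<le> p * t" by (intro mult_left_mono) auto
      with t s show False by linarith
    qed
    then consider "t = 0" | "t = 1" by linarith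
    then have False
    proof cases
      case 1
      with t e have "p * s1 = p * p" by simp
      then have "s1 = p" using p_ge by (simp only: mult_cancel1) simp
      then show False
        using mixed_type[OF PN f] t 1 lt by (simp add: s0_def s1_def)
    next
      case t1: 2
      with t e have "p * (s1 + 1) = p * p" by simp
      then have s1: "s1 + 1 = p" using p_ge by (simp only: mult_cancel1) simp
      define A B where "A = n0 + p * n1" and "B = n2 + p * n3"
      have "x ^ n = x ^ A * (x ^ (p\<^sup>2)) ^ B" for x :: 'a
        unfolding f A_def B_def power_add
        by (simp only: power_mult[symmetric] mult_ac)
      moreover have "A + B = s0 + p * s1" by (simp add: A_def B_def s0_def s1_def algebra_simps)
      then have "A + B = p\<^sup>2 + 3" using e by (simp add: power2_eq_square)
      moreover have "n0 + n2 = p + 3" using t t1 by (simp add: s0_def)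
      \<comment> \<open>Two digits below p with sum p + 3 are both at least 4.\<close>
      then have "4 \<le> A mod p" "4 \<le> B mod p" using lt by (simp_all add: A_def B_def)
      ultimately show False using norm_type[OF disjI2[OF refl] PN, of A B] by blast
    qed
    then show ?thesis ..
  qed
qed

text \<open>The prime field gives n = 4 modulo p - 1, which on the field of order p ^ 2 leaves digit
  sum 4 or p + 3 for the reduced exponent. The second is excluded by \<open>norm_type\<close>; in
  the first one digit is zero by \<open>weight_four\<close>.\<close>

lemma exponent_mod:
  assumes PN: "PN3 (\<lambda>x::'a. x ^ n)" and "n > 0"
  shows "n mod (p\<^sup>2 - 1) = 4 \<or> n mod (p\<^sup>2 - 1) = 4 * p"
proof -
  define W where "W = p\<^sup>2 - 1"
  have pge: "5 * p \<le> p\<^sup>2" using p_ge by (simp add: power2_eq_square)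
  have W: "W + 1 = p\<^sup>2" "4 * p < W" using pge p_ge unfolding W_def by linarith+
  define d where "d = (n - 1) mod (p - 1) + 1"
  have nd: "n = d + (p - 1) * ((n - 1) div (p - 1))"
    using \<open>n > 0\<close> mod_mult_div_eq[of "n - 1" "p - 1"] by (simp add: d_def)
  have d4: "d = 4"
  proof (rule prime_field_exponent[OF PN])
    have "(n - 1) mod (p - 1) < p - 1" using p_ge by simp
    then show "1 \<le> d" "d \<le> p - 1" by (simp_all add: d_def)
    show "x ^ n = x ^ d" if "x ^ p = x" for x :: 'a
      by (subst nd) (rule power_reduce_exponent[OF that], use p_ge in \<open>simp_all add: d_def\<close>)
  qed
  define N where "N = (n - 1) mod W + 1"
  define K where "K = (n - 1) div W"
  have nN: "n = N + W * K"
    using \<open>n > 0\<close> mod_mult_div_eq[of "n - 1" W] by (simp add: N_def K_def)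
  have "(n - 1) mod W < W" using W by simp
  then have N: "1 \<le> N" "N < p\<^sup>2" unfolding N_def W(1)[symmetric] by simp_all
  define A where "A = N mod p"
  define B where "B = N div p"
  have NAB: "N = A + p * B" by (simp add: A_def B_def)
  have AB: "A < p" "B < p"
    using N p_ge by (simp_all add: A_def B_def less_mult_imp_div_less power2_eq_square)
  have fK: "x ^ n = x ^ A * (x ^ p) ^ B" if "x ^ (p\<^sup>2) = x" for x :: 'a
  proof -
    have "x ^ n = x ^ N"
      unfolding nN W_def by (rule power_reduce_exponent[OF that]) (use N p_ge in simp_all)
    then show ?thesis by (simp add: NAB power_add power_mult)
  qed
  have "(A + B) mod (p - 1) = 4 mod (p - 1)"
  proof -
    define r where "r = p - 1"
    have r: "p = r + 1" using p_ge by (simp add: r_def)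
    have Wr: "W = r * (r + 2)" by (simp add: W_def r power2_eq_square)
    have "n = (A + B) + r * (B + (r + 2) * K)"
      unfolding nN NAB Wr r by (simp add: algebra_simps)
    then have "n = (A + B) + (p - 1) * (B + (r + 2) * K)" by (simp only: r_def)
    then have "n mod (p - 1) = (A + B) mod (p - 1)" by (metis mod_mult_self2)
    moreover have "n mod (p - 1) = 4 mod (p - 1)" using nd d4 by (metis mod_mult_self2)
    ultimately show ?thesis by simp
  qed
  define e where "e = p - 1"
  define k where "k = (A + B) div e"
  have "A + B \<noteq> 0" using NAB N by (intro notI) simp
  have "A + B = 4 \<or> A + B = p + 3"
  proof -
    have e: "e + 1 = p" using p_ge by (simp add: e_def)
    have m: "(A + B) mod e = 4 mod e" using \<open>(A + B) mod (p - 1) = 4 mod (p - 1)\<close> by (simp only: e_def)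
    have le: "A + B \<le> 2 * e" using AB e by linarith
    show ?thesis
    \<comment> \<open>For p = 5 the residue of 4 modulo e is 0, so A + B is a positive multiple of 4
      not above 8, which is again 4 or p + 3.\<close>
    proof (cases "e = 4")
      case True
      then have "(A + B) mod 4 = 0" using m by simp
      then show ?thesis using True le e \<open>A + B \<noteq> 0\<close> by presburger
    next
      case False
      then have "(A + B) mod e = 4" using m e p_ge by simp
      then have ek: "A + B = 4 + e * k" using mult_div_mod_eq[of e "A + B"] by (simp add: k_def)
      have "k < 2"
      proof (rule ccontr)
        assume "\<not> k < 2"
        then have "e * 2 \<le> e * k" by (intro mult_left_mono) auto
        with ek le show False by linarith
      qed
      then consider "k = 0" | "k = 1" by linarith
      then show ?thesis using ek e by cases auto
    qed
  qed
  moreover have "A + B \<noteq> p + 3"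
  proof
    assume sum: "A + B = p + 3"
    then have "4 \<le> A mod p" "4 \<le> B mod p" using AB by simp_all
    then show False using norm_type[OF disjI1[OF refl] PN fK sum] by blast
  qed
  ultimately have sum4: "A + B = 4" by simp
  then have "A = 0 \<or> B = 0" using weight_four[OF disjI1[OF refl] PN fK sum4] by auto
  then have "N = 4 \<or> N = 4 * p" using sum4 NAB by auto
  moreover from this have "N < W" using W(2) p_ge by auto
  then have "n mod W = N" unfolding nN by simp
  ultimately show ?thesis by (simp only: W_def)
qed

end

section \<open>From the definition of k-PN to the exponent 4\<close>

text \<open>The centred difference at x is the finite difference in directions 2 * a, 2 * b, 2 * c
  at x - a - b - c, and these directions are nonzero because 2 is.\<close>

lemma k_PN_imp_PN3:
  fixes f :: "'a::{field,finite} poly"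
  assumes "k_PN 3 f" "(2::'a) \<noteq> 0"
  shows "PN3 (poly f)"
  unfolding PN3_def
proof (intro allI impI)
  fix a b c :: 'a assume abc: "a \<noteq> 0" "b \<noteq> 0" "c \<noteq> 0"
  define u where "u i = (if i = 1 then 2 * a else if i = 2 then 2 * b else 2 * c)" for i :: nat
  have "bij (poly (finite_difference 3 u f))"
    using assms abc unfolding k_PN_def by (auto simp: u_def)
  then have "inj (poly (finite_difference 3 u f))" by (rule bij_is_inj)
  moreover have "cdiff (poly f) a b c x = poly (finite_difference 3 u f) (x - a - b - c)" for x
    by (simp add: cdiff_def numeral_3_eq_3 u_def poly_pcompose Let_def algebra_simps)
  ultimately have "cdiff (poly f) a b c x = cdiff (poly f) a b c y \<Longrightarrow> x - a - b - c = y - a - b - c" for x y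
    by (simp only: inj_eq)
  then show "inj (cdiff (poly f) a b c)" by (intro injI) simp
qed

theorem theorem1p6:
  fixes p n :: nat
  assumes "prime p" and "p \<ge> 5"
    and "CARD('a::{field,finite}) = p ^ 4"
    and "n \<le> p ^ 4 - 1" and "\<not> p dvd n"
    and "k_PN 3 (monom 1 n :: 'a poly)"
  shows "n = 4"
proof -
  interpret quartic_field p "TYPE('a)"
    using assms by unfold_locales auto
  have "poly (monom 1 n) = (\<lambda>x::'a. x ^ n)" by (simp add: fun_eq_iff poly_monom)
  then have PN: "PN3 (\<lambda>x::'a. x ^ n)"
    using k_PN_imp_PN3[OF assms(6)] by simp
  have n0: "n > 0" using assms(5) by (intro Nat.gr0I) auto
  define W where "W = p\<^sup>2 - 1"
  have W: "p\<^sup>2 = W + 1" and W4: "4 < W"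
    using p_ge by (simp_all add: W_def power2_eq_square) (use mult_le_mono[of 5 p 5 p] in simp)
  define a where "a = n mod p"
  define b where "b = n div p mod p"
  define c where "c = n div p div p mod p"
  define d where "d = n div p div p div p"
  have n: "n = a + p * (b + p * (c + p * d))"
    by (simp add: a_def b_def c_def d_def)
  have "n < p ^ 4" using assms(4) p_ge by (cases "p ^ 4") auto
  then have lt: "a < p" "b < p" "c < p" "d < p"
    using p_ge by (simp_all add: a_def b_def c_def d_def less_mult_imp_div_less eval_nat_numeral mult_ac)
  have a0: "a \<noteq> 0" using assms(5) by (simp add: a_def mod_eq_0_iff_dvd)
  have f: "x ^ n = x ^ a * (x ^ p) ^ b * (x ^ (p\<^sup>2)) ^ c * ((x ^ p) ^ (p\<^sup>2)) ^ d" for x :: 'a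
  proof -
    have "n = a + p * b + p\<^sup>2 * c + p * p\<^sup>2 * d" by (subst n) (simp add: algebra_simps power2_eq_square)
    then show ?thesis by (simp add: power_add power_mult)
  qed
  have pW: "p * p = W + 1" using W by (simp add: power2_eq_square)
  show ?thesis
    using exponent_mod[OF PN n0]
  proof
    assume m4: "n mod (p\<^sup>2 - 1) = 4"
    \<comment> \<open>As p ^ 2 = 1 modulo W, digits two places apart are added.\<close>
    have "n = (a + c + p * (b + d)) + W * (c + p * d)"
    proof -
      have "n = a + p * b + p * p * (c + p * d)" by (subst n) (simp add: algebra_simps)
      then show ?thesis unfolding pW by (simp add: algebra_simps)
    qed
    then have "(a + c + p * (b + d)) mod (p\<^sup>2 - 1) = 4" using m4 by (metis W_def mod_mult_self2)
    from digits_of_PN3[OF PN f lt this] a0 show ?thesis using n by auto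
  next
    \<comment> \<open>Multiplying n by p turns the residue 4 * p into 4 and rotates the digits to d,
      a, b, c; \<open>digits_of_PN3\<close> then forces a = 0, against n not being divisible by
      p.\<close>
    assume m4: "n mod (p\<^sup>2 - 1) = 4 * p"
    have f': "x ^ (p * n) = x ^ d * (x ^ p) ^ a * (x ^ (p\<^sup>2)) ^ b * ((x ^ p) ^ (p\<^sup>2)) ^ c" for x :: 'a
    proof -
      have "((x ^ p) ^ p) ^ (p\<^sup>2) = x"
        using frob4[of x] by (simp add: power_mult[symmetric] eval_nat_numeral mult_ac)
      then show ?thesis
        unfolding power_mult[of x p n] f[of "x ^ p"] by (simp add: power_mult power2_eq_square mult_ac)
    qed
    have "p * n = (d + b + p * (a + c)) + W * (b + p * c + (W + 2) * d)"
    proof -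
      have "p * n = p * a + p * p * b + p * p * p * c + (p * p) * (p * p) * d"
        by (subst n) (simp add: algebra_simps)
      then show ?thesis unfolding pW by (simp add: algebra_simps)
    qed
    then have "(d + b + p * (a + c)) mod W = (p * n) mod W" by (metis mod_mult_self2)
    also have "\<dots> = (p * (4 * p)) mod W" using m4 by (metis W_def mod_mult_right_eq)
    also have "p * (4 * p) = 4 + W * 4" using pW by simp
    also have "(4 + W * 4) mod W = 4" using W4 by simp
    finally have "(d + b + p * (a + c)) mod (p\<^sup>2 - 1) = 4" by (simp only: W_def)
    from digits_of_PN3[OF PN3_shift[OF PN] f' lt(4,1,2,3) this] a0 show ?thesis by simp
  qed
qed

end
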